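(* Let $(A,p_l)$ be a weakly amenable Fréchet algebra. Then for each $n\in\mathbb{N}$, the Fréchet algebra $A^{\#}$ is $2n$-weakly amenable if and only if $A$ is $2n$-weakly amenable.
   Context: All spaces are complex and $\mathbb{N}=\{1,2,\dots\}$. A Fréchet algebra $(A,p_l)$ is an algebra that is complete and Hausdorff for the topology generated by a separating, increasing sequence $(p_l)_{l\in\mathbb{N}}$ of submultiplicative seminorms. The unitization of $A$ is $A^{\#}=A\oplus\mathbb{C}e$ with product $(a,\lambda)(b,\mu)=(ab+\mu a+\lambda b,\lambda\mu)$ and seminorms $q_l(a,\lambda)=p_l(a)+|\lambda|$; it is a Fréchet algebra with identity $e=(0,1)$. For a locally convex space $X$, $X^*$ is its continuous dual with the strong topology (uniform convergence on bounded subsets of $X$); $X^{(0)}=X$ and $X^{(n)}=(X^{(n-1)})^*$. If $B$ is a Fréchet algebra and $X$ a locally convex $B$-bimodule, then $X^*$ is a $B$-bimodule via $\langle b\cdot f,x\rangle=\langle f,x\cdot b\rangle$ and $\langle f\cdot b,x\rangle=\langle f,b\cdot x\rangle$; iterating, every $X^{(n)}$ is a $B$-bimodule. $B$ is a bimodule over itself by multiplication. A continuous derivation $D:B\to X$ is a continuous linear map with $D(ab)=a\cdot D(b)+D(a)\cdot b$ for all $a,b\in B$; it is inner if there is $x\in X$ with $D(b)=b\cdot x-x\cdot b$ for all $b\in B$. $B$ is $n$-weakly amenable if every continuous derivation $B\to B^{(n)}$ is inner; weakly amenable means $1$-weakly amenable. *)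

theory Defs
  imports "HOL-Analysis.Analysis"
begin

section \<open>Complex algebras and their unitizations\<close>

class complex_algebra = ring +
  fixes scaleC :: "complex \<Rightarrow> 'a \<Rightarrow> 'a" (infixr "*\<^sub>C" 75)
  assumes scaleC_add_right: "c *\<^sub>C (x + y) = c *\<^sub>C x + c *\<^sub>C y"
    and scaleC_add_left: "(c + d) *\<^sub>C x = c *\<^sub>C x + d *\<^sub>C x"
    and scaleC_scaleC: "c *\<^sub>C d *\<^sub>C x = (c * d) *\<^sub>C x"
    and scaleC_one: "1 *\<^sub>C x = x"
    and mult_scaleC_left: "(c *\<^sub>C x) * y = c *\<^sub>C (x * y)"
    and mult_scaleC_right: "x * (c *\<^sub>C y) = c *\<^sub>C (x * y)"

datatype 'a unitization = Unitization (algebra_part: 'a) (scalar_part: complex)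

instantiation unitization :: (complex_algebra) complex_algebra
begin

definition "0 = Unitization 0 0"
definition "x + y = Unitization (algebra_part x + algebra_part y) (scalar_part x + scalar_part y)"
definition "- x = Unitization (- algebra_part x) (- scalar_part x)"
definition "x - y = Unitization (algebra_part x - algebra_part y) (scalar_part x - scalar_part y)"
definition "c *\<^sub>C x = Unitization (c *\<^sub>C algebra_part x) (c * scalar_part x)"
definition "x * y =
  Unitization (algebra_part x * algebra_part y + scalar_part y *\<^sub>C algebra_part x
                 + scalar_part x *\<^sub>C algebra_part y)
              (scalar_part x * scalar_part y)"

instance
  by intro_classes
    (simp_all add: zero_unitization_def plus_unitization_def uminus_unitization_def
      minus_unitization_def scaleC_unitization_def times_unitization_def
      scaleC_add_right scaleC_add_left scaleC_scaleC scaleC_one mult_scaleC_left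
      mult_scaleC_right algebra_simps)

end

section \<open>Frechet algebras\<close>

definition seminorm_topology :: "'x::minus set \<Rightarrow> ('x \<Rightarrow> real) set \<Rightarrow> 'x topology" where
  "seminorm_topology V Q =
     topology_generated_by {{y \<in> V. q (y - x) < r} | q x r. q \<in> Q \<and> x \<in> V \<and> 0 < r}"

definition algebra_topology :: "(nat \<Rightarrow> 'a::complex_algebra \<Rightarrow> real) \<Rightarrow> 'a topology" where
  "algebra_topology p = seminorm_topology UNIV (range p)"

definition submultiplicative_seminorm :: "('a::complex_algebra \<Rightarrow> real) \<Rightarrow> bool" where
  "submultiplicative_seminorm q \<longleftrightarrow>
     (\<forall>x. 0 \<le> q x) \<and>
     (\<forall>x y. q (x + y) \<le> q x + q y) \<and>
     (\<forall>c x. q (c *\<^sub>C x) = cmod c * q x) \<and>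
     (\<forall>x y. q (x * y) \<le> q x * q y)"

text \<open>The seminorms are indexed from \<open>0\<close>. The topology is metrizable, so that completeness
  may be expressed by sequences.\<close>

definition frechet_algebra :: "(nat \<Rightarrow> 'a::complex_algebra \<Rightarrow> real) \<Rightarrow> bool" where
  "frechet_algebra p \<longleftrightarrow>
     (\<forall>l. submultiplicative_seminorm (p l)) \<and>
     (\<forall>l x. p l x \<le> p (Suc l) x) \<and>
     (\<forall>x. (\<forall>l. p l x = 0) \<longrightarrow> x = 0) \<and>
     (\<forall>s :: nat \<Rightarrow> 'a.
        (\<forall>l. \<forall>\<epsilon>>0. \<exists>N. \<forall>m\<ge>N. \<forall>n\<ge>N. p l (s m - s n) < \<epsilon>) \<longrightarrow>
        (\<exists>x. limitin (algebra_topology p) s x sequentially))"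

definition unitization_seminorms ::
    "(nat \<Rightarrow> 'a::complex_algebra \<Rightarrow> real) \<Rightarrow> nat \<Rightarrow> 'a unitization \<Rightarrow> real" where
  "unitization_seminorms p l x = p l (algebra_part x) + cmod (scalar_part x)"

section \<open>Topological bimodules and strong duals\<close>

text \<open>\<open>('b, 'x) bimodule\<close> is the raw structure of a topological bimodule over \<open>'b\<close> whose elements
  form a subset of \<open>'x\<close>. The bimodules below are all obtained from an algebra by taking duals,
  hence no axioms are imposed here.\<close>

record ('b, 'x) bimodule =
  bcarrier :: "'x set"
  bzero :: 'x
  badd :: "'x \<Rightarrow> 'x \<Rightarrow> 'x"
  bscale :: "complex \<Rightarrow> 'x \<Rightarrow> 'x"
  btop :: "'x topology"
  lact :: "'b \<Rightarrow> 'x \<Rightarrow> 'x"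
  ract :: "'x \<Rightarrow> 'b \<Rightarrow> 'x"

definition regular_bimodule ::
    "(nat \<Rightarrow> 'b::complex_algebra \<Rightarrow> real) \<Rightarrow> ('b, 'b) bimodule" where
  "regular_bimodule p =
     \<lparr>bcarrier = UNIV, bzero = 0, badd = (+), bscale = scaleC, btop = algebra_topology p,
      lact = (*), ract = (*)\<rparr>"

definition bounded_in :: "('b, 'x) bimodule \<Rightarrow> 'x set \<Rightarrow> bool" where
  "bounded_in X S \<longleftrightarrow> S \<subseteq> bcarrier X \<and>
     (\<forall>U. openin (btop X) U \<and> bzero X \<in> U \<longrightarrow>
        (\<exists>r>0. \<forall>c. r \<le> cmod c \<longrightarrow> S \<subseteq> bscale X c ` U))"

text \<open>Functionals are made extensional by the value \<open>0\<close> outside of the carrier.\<close>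

definition continuous_functionals :: "('b, 'x) bimodule \<Rightarrow> ('x \<Rightarrow> complex) set" where
  "continuous_functionals X =
     {f. continuous_map (btop X) euclidean f \<and>
         (\<forall>x\<in>bcarrier X. \<forall>y\<in>bcarrier X. f (badd X x y) = f x + f y) \<and>
         (\<forall>c. \<forall>x\<in>bcarrier X. f (bscale X c x) = c * f x) \<and>
         (\<forall>x. x \<notin> bcarrier X \<longrightarrow> f x = 0)}"

definition strong_dual :: "('b, 'x) bimodule \<Rightarrow> ('b, 'x \<Rightarrow> complex) bimodule" where
  "strong_dual X =
     \<lparr>bcarrier = continuous_functionals X,
      bzero = (\<lambda>x. 0),
      badd = (\<lambda>f g x. f x + g x),
      bscale = (\<lambda>c f x. c * f x),
      btop = seminorm_topology (continuous_functionals X)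
               {(\<lambda>f. SUP x\<in>S. cmod (f x)) | S. bounded_in X S \<and> S \<noteq> {}},
      lact = (\<lambda>b f x. if x \<in> bcarrier X then f (ract X x b) else 0),
      ract = (\<lambda>f b x. if x \<in> bcarrier X then f (lact X b x) else 0)\<rparr>"

section \<open>Iterated duals\<close>

definition bimodule_isomorphism ::
    "('b, 'x) bimodule \<Rightarrow> ('b, 'y) bimodule \<Rightarrow> ('x \<Rightarrow> 'y) \<Rightarrow> bool" where
  "bimodule_isomorphism X Y \<phi> \<longleftrightarrow>
     bij_betw \<phi> (bcarrier X) (bcarrier Y) \<and>
     homeomorphic_map (btop X) (btop Y) \<phi> \<and>
     \<phi> (bzero X) = bzero Y \<and>
     (\<forall>x\<in>bcarrier X. \<forall>y\<in>bcarrier X. \<phi> (badd X x y) = badd Y (\<phi> x) (\<phi> y)) \<and>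
     (\<forall>c. \<forall>x\<in>bcarrier X. \<phi> (bscale X c x) = bscale Y c (\<phi> x)) \<and>
     (\<forall>b. \<forall>x\<in>bcarrier X. \<phi> (lact X b x) = lact Y b (\<phi> x)) \<and>
     (\<forall>b. \<forall>x\<in>bcarrier X. \<phi> (ract X x b) = ract Y (\<phi> x) b)"

definition bimodule_isomorphic :: "('b, 'x) bimodule \<Rightarrow> ('b, 'y) bimodule \<Rightarrow> bool" where
  "bimodule_isomorphic X Y \<longleftrightarrow> (\<exists>\<phi>. bimodule_isomorphism X Y \<phi>)"

text \<open>The type of \<open>strong_dual X\<close> is larger than that of \<open>X\<close>, so \<open>strong_dual\<close> cannot be iterated a
  variable number of times. Instead \<open>iterated_dual p n X\<close> says that \<open>X\<close> is the \<open>n\<close>-th dual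
  of the algebra \<open>'b\<close> topologized by \<open>p\<close>, up to a homeomorphic isomorphism of bimodules, where
  all duals up to the \<open>n\<close>-th are realized on subsets of one type \<open>'u\<close>. Such a type exists for
  each \<open>n\<close>: see \<open>has_iterated_dual_0\<close> and \<open>has_iterated_dual_Suc\<close> below. The direction of the
  isomorphisms matters: it forces the operations of the realization to preserve its carrier.\<close>

inductive iterated_dual ::
    "(nat \<Rightarrow> 'b::complex_algebra \<Rightarrow> real) \<Rightarrow> nat \<Rightarrow> ('b, 'u) bimodule \<Rightarrow> bool"
  for p where
  zero: "bimodule_isomorphic (regular_bimodule p) X \<Longrightarrow> iterated_dual p 0 X"
| Suc: "iterated_dual p n X \<Longrightarrow> bimodule_isomorphic (strong_dual X) Y \<Longrightarrow>
          iterated_dual p (Suc n) Y"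

definition has_iterated_dual ::
    "'u itself \<Rightarrow> nat \<Rightarrow> (nat \<Rightarrow> 'b::complex_algebra \<Rightarrow> real) \<Rightarrow> bool" where
  "has_iterated_dual _ n p \<longleftrightarrow> (\<exists>X :: ('b, 'u) bimodule. iterated_dual p n X)"

section \<open>Derivations and weak amenability\<close>

definition continuous_derivation ::
    "(nat \<Rightarrow> 'b::complex_algebra \<Rightarrow> real) \<Rightarrow> ('b, 'x) bimodule \<Rightarrow> ('b \<Rightarrow> 'x) \<Rightarrow> bool" where
  "continuous_derivation p X D \<longleftrightarrow>
     continuous_map (algebra_topology p) (btop X) D \<and>
     (\<forall>a. D a \<in> bcarrier X) \<and>
     (\<forall>a b. D (a + b) = badd X (D a) (D b)) \<and>
     (\<forall>c a. D (c *\<^sub>C a) = bscale X c (D a)) \<and>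
     (\<forall>a b. D (a * b) = badd X (lact X a (D b)) (ract X (D a) b))"

definition inner_derivation :: "('b, 'x) bimodule \<Rightarrow> ('b \<Rightarrow> 'x) \<Rightarrow> bool" where
  "inner_derivation X D \<longleftrightarrow>
     (\<exists>x\<in>bcarrier X. \<forall>b. D b = badd X (lact X b x) (bscale X (-1) (ract X x b)))"

definition weakly_amenable :: "(nat \<Rightarrow> 'b::complex_algebra \<Rightarrow> real) \<Rightarrow> bool" where
  "weakly_amenable p \<longleftrightarrow>
     (\<forall>D. continuous_derivation p (strong_dual (regular_bimodule p)) D \<longrightarrow>
          inner_derivation (strong_dual (regular_bimodule p)) D)"

text \<open>This is meaningful if \<open>has_iterated_dual TYPE('u) n p\<close>. It then depends neither on the
  realization of the \<open>n\<close>-th dual nor on \<open>'u\<close>: see \<open>n_weakly_amenable_iff\<close> below. The case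
  \<open>n = 1\<close> is \<open>weakly_amenable\<close>: see \<open>weakly_amenable_iff\<close>.\<close>

definition n_weakly_amenable ::
    "'u itself \<Rightarrow> nat \<Rightarrow> (nat \<Rightarrow> 'b::complex_algebra \<Rightarrow> real) \<Rightarrow> bool" where
  "n_weakly_amenable _ n p \<longleftrightarrow>
     (\<forall>X :: ('b, 'u) bimodule. iterated_dual p n X \<longrightarrow>
        (\<forall>D. continuous_derivation p X D \<longrightarrow> inner_derivation X D))"

section \<open>Existence and uniqueness of iterated duals\<close>

locale proper_bimodule =
  fixes X :: "('b, 'x) bimodule"
  assumes topspace_btop: "topspace (btop X) = bcarrier X"
    and bzero_closed: "bzero X \<in> bcarrier X"
    and badd_closed: "x \<in> bcarrier X \<Longrightarrow> y \<in> bcarrier X \<Longrightarrow> badd X x y \<in> bcarrier X"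
    and bscale_closed: "x \<in> bcarrier X \<Longrightarrow> bscale X c x \<in> bcarrier X"
    and bscale_0: "x \<in> bcarrier X \<Longrightarrow> bscale X 0 x = bzero X"
    and bscale_bzero: "bscale X c (bzero X) = bzero X"
    and lact_continuous: "continuous_map (btop X) (btop X) (lact X b)"
    and ract_continuous: "continuous_map (btop X) (btop X) (\<lambda>x. ract X x b)"
    and lact_badd: "x \<in> bcarrier X \<Longrightarrow> y \<in> bcarrier X \<Longrightarrow>
          lact X b (badd X x y) = badd X (lact X b x) (lact X b y)"
    and ract_badd: "x \<in> bcarrier X \<Longrightarrow> y \<in> bcarrier X \<Longrightarrow>
          ract X (badd X x y) b = badd X (ract X x b) (ract X y b)"
    and lact_bscale: "x \<in> bcarrier X \<Longrightarrow> lact X b (bscale X c x) = bscale X c (lact X b x)"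
    and ract_bscale: "x \<in> bcarrier X \<Longrightarrow> ract X (bscale X c x) b = bscale X c (ract X x b)"
begin

lemma lact_closed: "x \<in> bcarrier X \<Longrightarrow> lact X b x \<in> bcarrier X"
  using lact_continuous topspace_btop by (metis continuous_map_image_subset_topspace image_subset_iff)

lemma ract_closed: "x \<in> bcarrier X \<Longrightarrow> ract X x b \<in> bcarrier X"
  using ract_continuous[of b] topspace_btop
  by (metis (no_types, lifting) continuous_map_image_subset_topspace image_subset_iff)

end

definition continuous_linear :: "('b, 'x) bimodule \<Rightarrow> ('b, 'y) bimodule \<Rightarrow> ('x \<Rightarrow> 'y) \<Rightarrow> bool" where
  "continuous_linear X Y T \<longleftrightarrow>
     continuous_map (btop X) (btop Y) T \<and>
     (\<forall>x\<in>bcarrier X. \<forall>y\<in>bcarrier X. T (badd X x y) = badd Y (T x) (T y)) \<and>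
     (\<forall>c. \<forall>x\<in>bcarrier X. T (bscale X c x) = bscale Y c (T x))"

definition pullback :: "('b, 'x) bimodule \<Rightarrow> ('x \<Rightarrow> 'y) \<Rightarrow> ('y \<Rightarrow> complex) \<Rightarrow> 'x \<Rightarrow> complex" where
  "pullback X T f = (\<lambda>x. if x \<in> bcarrier X then f (T x) else 0)"

lemma continuous_linear_closed:
  assumes "proper_bimodule X" "proper_bimodule Y" "continuous_linear X Y T" "x \<in> bcarrier X"
  shows "T x \<in> bcarrier Y"
  using assms continuous_map_image_subset_topspace[of "btop X" "btop Y" T]
  by (auto simp: continuous_linear_def proper_bimodule.topspace_btop)

lemma continuous_linear_zero:
  assumes X: "proper_bimodule X" and Y: "proper_bimodule Y" and T: "continuous_linear X Y T"
  shows "T (bzero X) = bzero Y"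
proof -
  have "T (bzero X) = T (bscale X 0 (bzero X))"
    using X by (simp add: proper_bimodule.bscale_0 proper_bimodule.bzero_closed)
  also have "\<dots> = bscale Y 0 (T (bzero X))"
    using T X by (simp add: continuous_linear_def proper_bimodule.bzero_closed)
  finally show ?thesis
    using continuous_linear_closed[OF X Y T] X Y
    by (simp add: proper_bimodule.bscale_0 proper_bimodule.bzero_closed)
qed

lemma bounded_in_image:
  assumes X: "proper_bimodule X" and Y: "proper_bimodule Y" and T: "continuous_linear X Y T"
    and S: "bounded_in X S"
  shows "bounded_in Y (T ` S)"
  unfolding bounded_in_def
proof (intro conjI allI impI)
  show "T ` S \<subseteq> bcarrier Y"
    using S continuous_linear_closed[OF X Y T] by (auto simp: bounded_in_def)
  fix U assume U: "openin (btop Y) U \<and> bzero Y \<in> U"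
  define V where "V = {x \<in> topspace (btop X). T x \<in> U}"
  have "openin (btop X) V"
    unfolding V_def using T U by (intro openin_continuous_map_preimage) (auto simp: continuous_linear_def)
  moreover have "bzero X \<in> V"
    using X U continuous_linear_zero[OF X Y T]
    by (auto simp: V_def proper_bimodule.topspace_btop proper_bimodule.bzero_closed)
  ultimately obtain r where r: "r > 0" "\<And>c. r \<le> cmod c \<Longrightarrow> S \<subseteq> bscale X c ` V"
    using S by (auto simp: bounded_in_def)
  have "T ` S \<subseteq> bscale Y c ` U" if c: "r \<le> cmod c" for c
  proof
    fix y assume "y \<in> T ` S"
    then obtain v where "v \<in> V" "y = T (bscale X c v)" using r(2)[OF c] by blast
    moreover have "v \<in> bcarrier X" using X \<open>v \<in> V\<close> by (auto simp: V_def proper_bimodule.topspace_btop)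
    ultimately show "y \<in> bscale Y c ` U" using T by (auto simp: continuous_linear_def V_def)
  qed
  with r(1) show "\<exists>r>0. \<forall>c. r \<le> cmod c \<longrightarrow> T ` S \<subseteq> bscale Y c ` U" by blast
qed

lemma bdd_above_functional:
  assumes X: "proper_bimodule X" and f: "f \<in> continuous_functionals X" and S: "bounded_in X S"
  shows "bdd_above ((\<lambda>x. cmod (f x)) ` S)"
proof -
  define U where "U = {x \<in> topspace (btop X). f x \<in> ball 0 1}"
  have "f (bzero X) = f (bscale X 0 (bzero X))"
    using X by (simp add: proper_bimodule.bscale_0 proper_bimodule.bzero_closed)
  also have "\<dots> = 0"
    using f X by (simp add: continuous_functionals_def proper_bimodule.bzero_closed)
  finally have "bzero X \<in> U"
    using X by (auto simp: U_def proper_bimodule.topspace_btop proper_bimodule.bzero_closed)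
  moreover have "openin (btop X) U"
    unfolding U_def using f by (intro openin_continuous_map_preimage) (auto simp: continuous_functionals_def)
  ultimately obtain r where r: "r > 0" "\<And>c. r \<le> cmod c \<Longrightarrow> S \<subseteq> bscale X c ` U"
    using S by (auto simp: bounded_in_def)
  have "cmod (f x) \<le> r" if "x \<in> S" for x
  proof -
    have "S \<subseteq> bscale X (of_real r) ` U" using r(1) by (intro r(2)) simp
    then obtain u where u: "u \<in> U" "x = bscale X (of_real r) u" using \<open>x \<in> S\<close> by blast
    have "u \<in> bcarrier X" using u X by (auto simp: U_def proper_bimodule.topspace_btop)
    then have "f x = of_real r * f u" using f u by (auto simp: continuous_functionals_def)
    moreover have "cmod (f u) \<le> 1" using u by (auto simp: U_def)
    ultimately show ?thesis using r(1) by (simp add: norm_mult)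
  qed
  then show ?thesis by (intro bdd_aboveI2)
qed

lemma diff_continuous_functional:
  assumes "f \<in> continuous_functionals X" "g \<in> continuous_functionals X"
  shows "f - g \<in> continuous_functionals X"
  using assms continuous_map_diff[of "btop X" f g]
  by (simp add: continuous_functionals_def fun_diff_def algebra_simps)

lemma strong_dual_simps [simp]:
  "bcarrier (strong_dual X) = continuous_functionals X"
  "bzero (strong_dual X) = (\<lambda>x. 0)"
  "badd (strong_dual X) = (\<lambda>f g x. f x + g x)"
  "bscale (strong_dual X) = (\<lambda>c f x. c * f x)"
  "lact (strong_dual X) b = pullback X (\<lambda>x. ract X x b)"
  "ract (strong_dual X) f b = pullback X (lact X b) f"
  by (simp_all add: strong_dual_def pullback_def fun_eq_iff)

lemma zero_continuous_functional: "(\<lambda>x. 0) \<in> continuous_functionals X"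
  by (auto simp: continuous_functionals_def)

lemma bounded_in_bzero:
  assumes X: "proper_bimodule X"
  shows "bounded_in X {bzero X}"
  unfolding bounded_in_def
proof (intro conjI allI impI)
  show "{bzero X} \<subseteq> bcarrier X" using X by (simp add: proper_bimodule.bzero_closed)
  fix U assume U: "openin (btop X) U \<and> bzero X \<in> U"
  have "{bzero X} \<subseteq> bscale X c ` U" for c
    using U proper_bimodule.bscale_bzero[OF X, of c] by force
  then show "\<exists>r>0. \<forall>c. r \<le> cmod c \<longrightarrow> {bzero X} \<subseteq> bscale X c ` U"
    by (intro exI[of _ 1]) auto
qed

lemma topspace_strong_dual:
  assumes X: "proper_bimodule X"
  shows "topspace (btop (strong_dual X)) = continuous_functionals X"
proof -
  let ?B = "{{y \<in> continuous_functionals X. q (y - x) < r} |q x r.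
      q \<in> {\<lambda>f. SUP x\<in>S. cmod (f x) |S. bounded_in X S \<and> S \<noteq> {}} \<and>
      x \<in> continuous_functionals X \<and> 0 < r}"
  have "\<Union>?B = continuous_functionals X"
  proof
    show "\<Union>?B \<subseteq> continuous_functionals X" by auto
    show "continuous_functionals X \<subseteq> \<Union>?B"
    proof
      fix f assume f: "f \<in> continuous_functionals X"
      define q :: "(_ \<Rightarrow> complex) \<Rightarrow> real" where "q f = (SUP x\<in>{bzero X}. cmod (f x))" for f
      show "f \<in> \<Union>?B"
      proof (rule UnionI)
        show "f \<in> {y \<in> continuous_functionals X. q (y - f) < 1}" using f by (simp add: q_def)
        show "{y \<in> continuous_functionals X. q (y - f) < 1} \<in> ?B"
        proof (rule CollectI, rule exI[of _ q], rule exI[of _ f], rule exI[of _ 1], intro conjI)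
          show "q \<in> {\<lambda>f. SUP x\<in>S. cmod (f x) |S. bounded_in X S \<and> S \<noteq> {}}"
            by (rule CollectI, rule exI[of _ "{bzero X}"])
              (simp add: q_def[abs_def] bounded_in_bzero[OF X])
        qed (use f in simp_all)
      qed
    qed
  qed
  then show ?thesis
    by (simp add: strong_dual_def seminorm_topology_def)
qed

lemma pullback_closed:
  assumes X: "proper_bimodule X" and Y: "proper_bimodule Y" and T: "continuous_linear X Y T"
    and f: "f \<in> continuous_functionals Y"
  shows "pullback X T f \<in> continuous_functionals X"
proof -
  have "continuous_map (btop X) euclidean (f \<circ> T)"
    using T f by (intro continuous_map_compose[of _ "btop Y"])
      (auto simp: continuous_linear_def continuous_functionals_def)
  then have "continuous_map (btop X) euclidean (pullback X T f)"
    by (rule continuous_map_eq) (simp add: pullback_def proper_bimodule.topspace_btop[OF X])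
  moreover have "pullback X T f (badd X x y) = pullback X T f x + pullback X T f y"
    if "x \<in> bcarrier X" "y \<in> bcarrier X" for x y
    using that T f continuous_linear_closed[OF X Y T] proper_bimodule.badd_closed[OF X]
    by (simp add: pullback_def continuous_linear_def continuous_functionals_def)
  moreover have "pullback X T f (bscale X c x) = c * pullback X T f x" if "x \<in> bcarrier X" for c x
    using that T f continuous_linear_closed[OF X Y T] proper_bimodule.bscale_closed[OF X]
    by (simp add: pullback_def continuous_linear_def continuous_functionals_def)
  ultimately show ?thesis
    by (simp add: continuous_functionals_def) (simp add: pullback_def)
qed

lemma pullback_continuous:
  assumes X: "proper_bimodule X" and Y: "proper_bimodule Y" and T: "continuous_linear X Y T"
  shows "continuous_map (btop (strong_dual Y)) (btop (strong_dual X)) (pullback X T)"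
proof -
  let ?B = "{{y \<in> continuous_functionals X. q (y - x) < r} |q x r.
      q \<in> {\<lambda>f. SUP x\<in>S. cmod (f x) |S. bounded_in X S \<and> S \<noteq> {}} \<and>
      x \<in> continuous_functionals X \<and> 0 < r}"
  have "continuous_map (btop (strong_dual Y)) (topology_generated_by ?B) (pullback X T)"
  proof (rule continuous_on_generated_topo)
    have "\<Union>?B = continuous_functionals X"
      using topspace_strong_dual[OF X] by (simp add: strong_dual_def seminorm_topology_def)
    then show "pullback X T ` topspace (btop (strong_dual Y)) \<subseteq> \<Union>?B"
      using pullback_closed[OF X Y T] topspace_strong_dual[OF Y] by auto
  next
    fix U assume "U \<in> ?B"
    then obtain S f0 r where S: "bounded_in X S" "S \<noteq> {}" and f0: "f0 \<in> continuous_functionals X"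
      and "0 < r"
      and U: "U = {f \<in> continuous_functionals X. (SUP x\<in>S. cmod ((f - f0) x)) < r}"
      by blast
    define P where "P f = (SUP x\<in>S. cmod (f x))" for f :: "_ \<Rightarrow> complex"
    define P' where "P' f = (SUP y\<in>T ` S. cmod (f y))" for f :: "_ \<Rightarrow> complex"
    have S_sub: "S \<subseteq> bcarrier X" using S by (simp add: bounded_in_def)
    have TS: "bounded_in Y (T ` S)" by (rule bounded_in_image[OF X Y T S(1)])
    show "openin (btop (strong_dual Y)) (pullback X T -` U \<inter> topspace (btop (strong_dual Y)))"
    proof (subst openin_subopen, intro ballI)
      fix f1 assume f1: "f1 \<in> pullback X T -` U \<inter> topspace (btop (strong_dual Y))"
      then have f1': "f1 \<in> continuous_functionals Y" by (simp add: topspace_strong_dual[OF Y])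
      define d where "d = r - P (pullback X T f1 - f0)"
      have "d > 0" using f1 by (simp add: d_def U P_def)
      define V where "V = {f \<in> continuous_functionals Y. P' (f - f1) < d}"
      have "openin (btop (strong_dual Y)) V"
        unfolding strong_dual_def seminorm_topology_def V_def bimodule.simps
        by (rule topology_generated_by_Basis, rule CollectI, rule exI[of _ P'], rule exI[of _ f1],
            rule exI[of _ d])
          (use TS S(2) f1' \<open>d > 0\<close> in \<open>auto simp: P'_def[abs_def]\<close>)
      moreover have "f1 \<in> V"
        using f1' \<open>d > 0\<close> S(2) by (simp add: V_def P'_def)
      moreover have "V \<subseteq> pullback X T -` U \<inter> topspace (btop (strong_dual Y))"
      proof
        fix f assume f: "f \<in> V"
        then have f': "f \<in> continuous_functionals Y" by (simp add: V_def)
        have bd1: "bdd_above ((\<lambda>y. cmod ((f - f1) y)) ` T ` S)"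
          by (rule bdd_above_functional[OF Y diff_continuous_functional[OF f' f1'] TS])
        have bd2: "bdd_above ((\<lambda>x. cmod ((pullback X T f1 - f0) x)) ` S)"
          by (rule bdd_above_functional[OF X diff_continuous_functional[OF pullback_closed[OF X Y T f1'] f0] S(1)])
        have "cmod ((pullback X T f - f0) x) \<le> P' (f - f1) + P (pullback X T f1 - f0)"
          if x: "x \<in> S" for x
        proof -
          have "(pullback X T f - f0) x = (f - f1) (T x) + (pullback X T f1 - f0) x"
            using S_sub x by (auto simp: pullback_def)
          then have "cmod ((pullback X T f - f0) x) \<le>
              cmod ((f - f1) (T x)) + cmod ((pullback X T f1 - f0) x)"
            by (metis norm_triangle_ineq)
          moreover have "cmod ((f - f1) (T x)) \<le> P' (f - f1)"
            unfolding P'_def by (rule cSUP_upper[OF _ bd1]) (use x in auto)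
          moreover have "cmod ((pullback X T f1 - f0) x) \<le> P (pullback X T f1 - f0)"
            unfolding P_def by (rule cSUP_upper[OF x bd2])
          ultimately show ?thesis by linarith
        qed
        then have "P (pullback X T f - f0) \<le> P' (f - f1) + P (pullback X T f1 - f0)"
          unfolding P_def[of "pullback X T f - f0"] by (intro cSUP_least[OF S(2)])
        also have "\<dots> < r" using f by (simp add: V_def d_def)
        finally show "f \<in> pullback X T -` U \<inter> topspace (btop (strong_dual Y))"
          using pullback_closed[OF X Y T f'] f' by (simp add: U P_def topspace_strong_dual[OF Y])
      qed
      ultimately show "\<exists>V. openin (btop (strong_dual Y)) V \<and> f1 \<in> V \<and>
          V \<subseteq> pullback X T -` U \<inter> topspace (btop (strong_dual Y))" by blast
    qed
  qed
  then show ?thesis by (simp add: strong_dual_def seminorm_topology_def)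
qed

lemma continuous_linear_act:
  assumes "proper_bimodule X"
  shows "continuous_linear X X (lact X b)" "continuous_linear X X (\<lambda>x. ract X x b)"
  using assms by (auto simp: continuous_linear_def proper_bimodule_def)

lemma proper_strong_dual:
  assumes X: "proper_bimodule X"
  shows "proper_bimodule (strong_dual X)"
proof
  fix f g c b
  note fb = pullback_closed[OF X X continuous_linear_act(1)[OF X]]
    pullback_closed[OF X X continuous_linear_act(2)[OF X]]
  show "topspace (btop (strong_dual X)) = bcarrier (strong_dual X)"
    by (simp add: topspace_strong_dual[OF X])
  show "bzero (strong_dual X) \<in> bcarrier (strong_dual X)"
    by (simp add: continuous_functionals_def)
  show "bscale (strong_dual X) c (bzero (strong_dual X)) = bzero (strong_dual X)"
    by simp
  show "continuous_map (btop (strong_dual X)) (btop (strong_dual X)) (lact (strong_dual X) b)"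
    using pullback_continuous[OF X X continuous_linear_act(2)[OF X]] by simp
  show "continuous_map (btop (strong_dual X)) (btop (strong_dual X)) (\<lambda>x. ract (strong_dual X) x b)"
    using pullback_continuous[OF X X continuous_linear_act(1)[OF X]] by (simp add: eta_contract_eq)
  assume f: "f \<in> bcarrier (strong_dual X)"
  show "bscale (strong_dual X) c f \<in> bcarrier (strong_dual X)"
  proof -
    have "continuous_map (btop X) euclidean ((\<lambda>z. c * z) \<circ> f)"
      using f by (intro continuous_map_compose[of _ euclidean])
        (auto simp: continuous_functionals_def continuous_on_mult_left)
    then show ?thesis using f by (simp add: continuous_functionals_def o_def algebra_simps)
  qed
  show "bscale (strong_dual X) 0 f = bzero (strong_dual X)" by simp
  show "lact (strong_dual X) b (bscale (strong_dual X) c f) =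
      bscale (strong_dual X) c (lact (strong_dual X) b f)"
    by (auto simp: pullback_def)
  show "ract (strong_dual X) (bscale (strong_dual X) c f) b =
      bscale (strong_dual X) c (ract (strong_dual X) f b)"
    by (auto simp: pullback_def)
  assume g: "g \<in> bcarrier (strong_dual X)"
  show "badd (strong_dual X) f g \<in> bcarrier (strong_dual X)"
    using f g by (auto simp: continuous_functionals_def algebra_simps intro: continuous_map_add)
  show "lact (strong_dual X) b (badd (strong_dual X) f g) =
      badd (strong_dual X) (lact (strong_dual X) b f) (lact (strong_dual X) b g)"
    by (auto simp: pullback_def)
  show "ract (strong_dual X) (badd (strong_dual X) f g) b =
      badd (strong_dual X) (ract (strong_dual X) f b) (ract (strong_dual X) g b)"
    by (auto simp: pullback_def)
qed

lemma bimodule_isomorphism_image: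
  "bimodule_isomorphism X Y \<phi> \<Longrightarrow> x \<in> bcarrier X \<Longrightarrow> \<phi> x \<in> bcarrier Y"
  by (meson bij_betwE bimodule_isomorphism_def)

lemma bimodule_isomorphism_sym:
  assumes X: "proper_bimodule X" and iso: "bimodule_isomorphism X Y \<phi>"
  shows "bimodule_isomorphism Y X (inv_into (bcarrier X) \<phi>)"
proof -
  let ?\<psi> = "inv_into (bcarrier X) \<phi>"
  have bij: "bij_betw \<phi> (bcarrier X) (bcarrier Y)" using iso by (simp add: bimodule_isomorphism_def)
  have \<psi>\<phi>: "?\<psi> (\<phi> x) = x" if "x \<in> bcarrier X" for x
    using bij_betw_inv_into_left[OF bij that] .
  have \<phi>\<psi>: "\<phi> (?\<psi> y) = y" if "y \<in> bcarrier Y" for y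
    using bij_betw_inv_into_right[OF bij that] .
  have \<psi>: "?\<psi> y \<in> bcarrier X" if "y \<in> bcarrier Y" for y
    using bij_betwE[OF bij_betw_inv_into[OF bij]] that by blast
  obtain g where g: "homeomorphic_maps (btop X) (btop Y) \<phi> g"
    using iso by (auto simp: bimodule_isomorphism_def homeomorphic_map_maps)
  have tX: "topspace (btop X) = bcarrier X" using X by (rule proper_bimodule.topspace_btop)
  have tY: "topspace (btop Y) = bcarrier Y"
    using iso tX bij by (metis bij_betw_imp_surj_on bimodule_isomorphism_def homeomorphic_imp_surjective_map)
  have "homeomorphic_map (btop Y) (btop X) g"
    using g by (meson homeomorphic_maps_map)
  moreover have "g y = ?\<psi> y" if "y \<in> topspace (btop Y)" for y
    using g that \<psi>[of y] \<phi>\<psi>[of y] by (metis homeomorphic_maps_def tX tY)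
  ultimately have "homeomorphic_map (btop Y) (btop X) ?\<psi>"
    by (rule homeomorphic_map_eq)
  moreover have "?\<psi> (bzero Y) = bzero X"
    using iso \<psi>\<phi>[of "bzero X"] X by (simp add: bimodule_isomorphism_def proper_bimodule.bzero_closed)
  moreover have "?\<psi> (badd Y x y) = badd X (?\<psi> x) (?\<psi> y)"
    if "x \<in> bcarrier Y" "y \<in> bcarrier Y" for x y
    using iso \<psi>\<phi>[of "badd X (?\<psi> x) (?\<psi> y)"] X that
    by (simp add: bimodule_isomorphism_def proper_bimodule.badd_closed \<psi> \<phi>\<psi>)
  moreover have "?\<psi> (bscale Y c x) = bscale X c (?\<psi> x)" if "x \<in> bcarrier Y" for c x
    using iso \<psi>\<phi>[of "bscale X c (?\<psi> x)"] X that
    by (simp add: bimodule_isomorphism_def proper_bimodule.bscale_closed \<psi> \<phi>\<psi>)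
  moreover have "?\<psi> (lact Y b x) = lact X b (?\<psi> x)" if "x \<in> bcarrier Y" for b x
    using iso \<psi>\<phi>[of "lact X b (?\<psi> x)"] X that
    by (simp add: bimodule_isomorphism_def proper_bimodule.lact_closed \<psi> \<phi>\<psi>)
  moreover have "?\<psi> (ract Y x b) = ract X (?\<psi> x) b" if "x \<in> bcarrier Y" for b x
    using iso \<psi>\<phi>[of "ract X (?\<psi> x) b"] X that
    by (simp add: bimodule_isomorphism_def proper_bimodule.ract_closed \<psi> \<phi>\<psi>)
  ultimately show ?thesis
    using bij_betw_inv_into[OF bij] by (simp add: bimodule_isomorphism_def)
qed

lemma bimodule_isomorphism_trans:
  assumes "bimodule_isomorphism X Y \<phi>" "bimodule_isomorphism Y Z \<psi>"
  shows "bimodule_isomorphism X Z (\<psi> \<circ> \<phi>)"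
  using assms bimodule_isomorphism_image[OF assms(1)]
    bij_betw_trans[of \<phi> "bcarrier X" "bcarrier Y" \<psi> "bcarrier Z"]
    homeomorphic_map_compose[of "btop X" "btop Y" \<phi> "btop Z" \<psi>]
  by (simp add: bimodule_isomorphism_def)

lemma bimodule_isomorphic_trans:
  "bimodule_isomorphic X Y \<Longrightarrow> bimodule_isomorphic Y Z \<Longrightarrow> bimodule_isomorphic X Z"
  by (meson bimodule_isomorphic_def bimodule_isomorphism_trans)

lemma bimodule_isomorphic_sym:
  "proper_bimodule X \<Longrightarrow> bimodule_isomorphic X Y \<Longrightarrow> bimodule_isomorphic Y X"
  by (meson bimodule_isomorphic_def bimodule_isomorphism_sym)

lemma proper_bimodule_isomorphic:
  assumes X: "proper_bimodule X" and XY: "bimodule_isomorphic X Y"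
  shows "proper_bimodule Y"
proof -
  obtain \<phi> where iso: "bimodule_isomorphism X Y \<phi>" using XY by (auto simp: bimodule_isomorphic_def)
  interpret X: proper_bimodule X by (rule X)
  define \<psi> where "\<psi> = inv_into (bcarrier X) \<phi>"
  have iso': "bimodule_isomorphism Y X \<psi>" unfolding \<psi>_def by (rule bimodule_isomorphism_sym[OF X iso])
  have bij: "bij_betw \<phi> (bcarrier X) (bcarrier Y)" using iso by (simp add: bimodule_isomorphism_def)
  have \<phi>\<psi>: "\<phi> (\<psi> y) = y" if "y \<in> bcarrier Y" for y
    using bij_betw_inv_into_right[OF bij that] by (simp add: \<psi>_def)
  note \<psi> = bimodule_isomorphism_image[OF iso'] and \<phi> = bimodule_isomorphism_image[OF iso]
  have hom: "\<phi> (bzero X) = bzero Y"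
    "\<And>x y. x \<in> bcarrier X \<Longrightarrow> y \<in> bcarrier X \<Longrightarrow> badd Y (\<phi> x) (\<phi> y) = \<phi> (badd X x y)"
    "\<And>c x. x \<in> bcarrier X \<Longrightarrow> bscale Y c (\<phi> x) = \<phi> (bscale X c x)"
    "\<And>b x. x \<in> bcarrier X \<Longrightarrow> lact Y b (\<phi> x) = \<phi> (lact X b x)"
    "\<And>b x. x \<in> bcarrier X \<Longrightarrow> ract Y (\<phi> x) b = \<phi> (ract X x b)"
    using iso by (simp_all add: bimodule_isomorphism_def)
  have ex: "\<exists>x. x \<in> bcarrier X \<and> y = \<phi> x" if "y \<in> bcarrier Y" for y
    using \<psi>[OF that] \<phi>\<psi>[OF that] by metis
  note cl = X.bzero_closed X.badd_closed X.bscale_closed X.lact_closed X.ract_closed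
  have tY: "topspace (btop Y) = bcarrier Y"
    using iso bij by (metis X.topspace_btop bij_betw_imp_surj_on bimodule_isomorphism_def homeomorphic_imp_surjective_map)
  have cont: "continuous_map (btop X) (btop Y) \<phi>" "continuous_map (btop Y) (btop X) \<psi>"
    using iso iso' by (auto simp: bimodule_isomorphism_def homeomorphic_imp_continuous_map)
  show ?thesis
  proof
    fix x y c b
    show "topspace (btop Y) = bcarrier Y" by (rule tY)
    show "bzero Y \<in> bcarrier Y" using \<phi>[OF X.bzero_closed] hom(1) by simp
    show "bscale Y c (bzero Y) = bzero Y"
      using hom(3)[OF X.bzero_closed, of c] hom(1) X.bscale_bzero by simp
    have "continuous_map (btop Y) (btop Y) (\<phi> \<circ> lact X b \<circ> \<psi>)"
      using cont X.lact_continuous by (meson continuous_map_compose)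
    then show "continuous_map (btop Y) (btop Y) (lact Y b)"
      by (rule continuous_map_eq) (simp add: tY \<psi> \<phi>\<psi> flip: hom(4))
    have "continuous_map (btop Y) (btop Y) (\<phi> \<circ> (\<lambda>x. ract X x b) \<circ> \<psi>)"
      using cont X.ract_continuous by (meson continuous_map_compose)
    then show "continuous_map (btop Y) (btop Y) (\<lambda>x. ract Y x b)"
      by (rule continuous_map_eq) (simp add: tY \<psi> \<phi>\<psi> flip: hom(5))
    assume "x \<in> bcarrier Y"
    then obtain x' where x': "x' \<in> bcarrier X" "x = \<phi> x'" using ex by blast
    show "bscale Y c x \<in> bcarrier Y" "bscale Y 0 x = bzero Y"
      "lact Y b (bscale Y c x) = bscale Y c (lact Y b x)"
      "ract Y (bscale Y c x) b = bscale Y c (ract Y x b)"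
      using x' by (simp_all add: hom cl \<phi> X.bscale_0 X.lact_bscale X.ract_bscale)
    assume "y \<in> bcarrier Y"
    then obtain y' where y': "y' \<in> bcarrier X" "y = \<phi> y'" using ex by blast
    show "badd Y x y \<in> bcarrier Y" "lact Y b (badd Y x y) = badd Y (lact Y b x) (lact Y b y)"
      "ract Y (badd Y x y) b = badd Y (ract Y x b) (ract Y y b)"
      using x' y' by (simp_all add: hom cl \<phi> X.lact_badd X.ract_badd)
  qed
qed

lemma bimodule_isomorphic_strong_dual:
  assumes X: "proper_bimodule X" and XY: "bimodule_isomorphic X Y"
  shows "bimodule_isomorphic (strong_dual X) (strong_dual Y)"
proof -
  obtain \<phi> where iso: "bimodule_isomorphism X Y \<phi>" using XY by (auto simp: bimodule_isomorphic_def)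
  have Y: "proper_bimodule Y" by (rule proper_bimodule_isomorphic[OF X XY])
  define \<psi> where "\<psi> = inv_into (bcarrier X) \<phi>"
  have iso': "bimodule_isomorphism Y X \<psi>" unfolding \<psi>_def by (rule bimodule_isomorphism_sym[OF X iso])
  have bij: "bij_betw \<phi> (bcarrier X) (bcarrier Y)" using iso by (simp add: bimodule_isomorphism_def)
  have inv: "\<And>y. y \<in> bcarrier Y \<Longrightarrow> \<phi> (\<psi> y) = y" "\<And>x. x \<in> bcarrier X \<Longrightarrow> \<psi> (\<phi> x) = x"
    using bij_betw_inv_into_right[OF bij] bij_betw_inv_into_left[OF bij] by (simp_all add: \<psi>_def)
  note \<psi> = bimodule_isomorphism_image[OF iso'] and \<phi> = bimodule_isomorphism_image[OF iso]
  have lin: "continuous_linear X Y \<phi>" "continuous_linear Y X \<psi>"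
    using iso iso' by (simp_all add: bimodule_isomorphism_def continuous_linear_def homeomorphic_imp_continuous_map)
  note pb = pullback_closed[OF X Y lin(1)] pullback_closed[OF Y X lin(2)]
  have pp: "pullback X \<phi> (pullback Y \<psi> f) = f" if "f \<in> continuous_functionals X" for f
    using that by (auto simp: pullback_def fun_eq_iff inv \<phi> continuous_functionals_def)
  have pp': "pullback Y \<psi> (pullback X \<phi> f) = f" if "f \<in> continuous_functionals Y" for f
    using that by (auto simp: pullback_def fun_eq_iff inv \<psi> continuous_functionals_def)
  have "bij_betw (pullback Y \<psi>) (continuous_functionals X) (continuous_functionals Y)"
    by (rule bij_betw_byWitness[where f' = "pullback X \<phi>"]) (auto simp: pp pp' pb)
  moreover have "homeomorphic_maps (btop (strong_dual X)) (btop (strong_dual Y)) (pullback Y \<psi>) (pullback X \<phi>)"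
    using pullback_continuous[OF X Y lin(1)] pullback_continuous[OF Y X lin(2)]
    by (simp add: homeomorphic_maps_def topspace_strong_dual X Y pp pp')
  moreover have "\<psi> (lact Y b y) = lact X b (\<psi> y)" "\<psi> (ract Y y b) = ract X (\<psi> y) b"
    if "y \<in> bcarrier Y" for b y
    using iso' that by (simp_all add: bimodule_isomorphism_def)
  ultimately have "bimodule_isomorphism (strong_dual X) (strong_dual Y) (pullback Y \<psi>)"
    unfolding bimodule_isomorphism_def
    by (auto simp: homeomorphic_map_maps pullback_def fun_eq_iff \<psi>
        proper_bimodule.lact_closed[OF Y] proper_bimodule.ract_closed[OF Y])
  then show ?thesis by (auto simp: bimodule_isomorphic_def)
qed

lemma proper_regular_bimodule:
  fixes p :: "nat \<Rightarrow> 'a::complex_algebra \<Rightarrow> real"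
  assumes p: "\<And>l. submultiplicative_seminorm (p l)"
  shows "proper_bimodule (regular_bimodule p)"
proof -
  have p_ge0: "0 \<le> p l x" and p_add: "p l (x + y) \<le> p l x + p l y"
    and p_mult: "p l (x * y) \<le> p l x * p l y" for l x y
    using p[of l] by (simp_all add: submultiplicative_seminorm_def)
  have scaleC_0: "0 *\<^sub>C x = 0" and scaleC_zero: "c *\<^sub>C (0::'a) = 0" for c and x :: 'a
    using scaleC_add_left[of 0 0 x] scaleC_add_right[of c "0::'a" 0] by simp_all
  have p_0: "p l 0 = 0" for l
    using p[of l] scaleC_0[of 0] unfolding submultiplicative_seminorm_def by (metis mult_zero_left norm_zero)
  let ?B = "{{y \<in> UNIV. q (y - x) < r} |q x r. q \<in> range p \<and> x \<in> UNIV \<and> 0 < r}"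
  have top: "algebra_topology p = topology_generated_by ?B"
    by (simp add: algebra_topology_def seminorm_topology_def)
  have "x \<in> {y \<in> UNIV. p 0 (y - x) < 1} \<and> {y \<in> UNIV. p 0 (y - x) < 1} \<in> ?B" for x
    by (auto simp: p_0 intro!: exI[of _ "p 0"] exI[of _ x] exI[of _ "1::real"])
  then have UB: "\<Union>?B = UNIV"
    by (metis (no_types, lifting) UNIV_eq_I UnionI)
  then have tsp: "topspace (algebra_topology p) = UNIV"
    unfolding top topology_generated_by_topspace .
  have cont: "continuous_map (algebra_topology p) (algebra_topology p) T"
    if T: "\<And>x y. T (x - y) = T x - T y" and K: "\<And>l x. p l (T x) \<le> K l * p l x" for T :: "'a \<Rightarrow> 'a" and K
  proof -
    have "continuous_map (algebra_topology p) (topology_generated_by ?B) T"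
    proof (rule continuous_on_generated_topo)
      show "T ` topspace (algebra_topology p) \<subseteq> \<Union>?B" unfolding UB by (rule subset_UNIV)
      fix U assume "U \<in> ?B"
      then obtain l x r where U: "U = {y. p l (y - x) < r}" and "0 < r" by auto
      show "openin (algebra_topology p) (T -` U \<inter> topspace (algebra_topology p))"
      proof (subst openin_subopen, intro ballI)
        fix z assume "z \<in> T -` U \<inter> topspace (algebra_topology p)"
        then have z: "p l (T z - x) < r" by (simp add: U)
        define d where "d = (r - p l (T z - x)) / (\<bar>K l\<bar> + 1)"
        have "d > 0" using z by (simp add: d_def)
        have "openin (algebra_topology p) {y. p l (y - z) < d}"
          unfolding top by (rule topology_generated_by_Basis, rule CollectI, rule exI[of _ "p l"],
              rule exI[of _ z], rule exI[of _ d]) (use \<open>d > 0\<close> in auto)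
        moreover have "p l (T y - x) < r" if y: "p l (y - z) < d" for y
        proof -
          have "p l (T y - x) \<le> p l (T (y - z)) + p l (T z - x)"
            using p_add[of l "T (y - z)" "T z - x"] by (simp add: T)
          also have "p l (T (y - z)) \<le> (\<bar>K l\<bar> + 1) * p l (y - z)"
            by (rule order_trans[OF K]) (intro mult_right_mono p_ge0, simp)
          also have "(\<bar>K l\<bar> + 1) * p l (y - z) < (\<bar>K l\<bar> + 1) * d"
            using y by (intro mult_strict_left_mono) auto
          also have "(\<bar>K l\<bar> + 1) * d = r - p l (T z - x)" by (simp add: d_def)
          finally show ?thesis by simp
        qed
        ultimately show "\<exists>V. openin (algebra_topology p) V \<and> z \<in> V \<and> V \<subseteq> T -` U \<inter> topspace (algebra_topology p)"
          using \<open>d > 0\<close> by (intro exI[of _ "{y. p l (y - z) < d}"]) (auto simp: U tsp p_0)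
      qed
    qed
    then show ?thesis by (simp only: top)
  qed
  have "continuous_map (algebra_topology p) (algebra_topology p) ((*) b)" for b
    by (rule cont[where K = "\<lambda>l. p l b"]) (auto simp: p_mult right_diff_distrib)
  moreover have "continuous_map (algebra_topology p) (algebra_topology p) (\<lambda>x. x * b)" for b
    by (rule cont[where K = "\<lambda>l. p l b"]) (use p_mult in \<open>auto simp: left_diff_distrib mult.commute\<close>)
  ultimately show ?thesis
    by unfold_locales
      (auto simp: regular_bimodule_def tsp scaleC_0 scaleC_zero algebra_simps mult_scaleC_left mult_scaleC_right)
qed

lemma submultiplicative_unitization_seminorms:
  assumes p: "submultiplicative_seminorm (p l)"
  shows "submultiplicative_seminorm (unitization_seminorms p l)"
proof -
  have p_ge0: "0 \<le> p l x" and p_add: "p l (x + y) \<le> p l x + p l y"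
    and p_scale: "p l (c *\<^sub>C x) = cmod c * p l x"
    and p_mult: "p l (x * y) \<le> p l x * p l y" for x y c
    using p by (simp_all add: submultiplicative_seminorm_def)
  have "p l (a * b + d *\<^sub>C a + c *\<^sub>C b) + cmod (c * d) \<le> (p l a + cmod c) * (p l b + cmod d)" for a b c d
  proof -
    have "p l (a * b + d *\<^sub>C a + c *\<^sub>C b) \<le> p l a * p l b + cmod d * p l a + cmod c * p l b"
      using p_add[of "a * b + d *\<^sub>C a" "c *\<^sub>C b"] p_add[of "a * b" "d *\<^sub>C a"] p_mult[of a b]
      by (simp add: p_scale)
    then show ?thesis by (simp add: norm_mult algebra_simps)
  qed
  moreover have "p l (a + b) + cmod (c + d) \<le> p l a + cmod c + (p l b + cmod d)" for a b c d
    using p_add[of a b] norm_triangle_ineq[of c d] by linarith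
  ultimately show ?thesis
    by (simp add: submultiplicative_seminorm_def unitization_seminorms_def plus_unitization_def
        times_unitization_def scaleC_unitization_def p_ge0 p_scale norm_mult distrib_left)
qed

lemma proper_iterated_dual:
  assumes "iterated_dual p n X" and p: "\<And>l. submultiplicative_seminorm (p l)"
  shows "proper_bimodule X"
  using assms(1)
proof induction
  case (zero X)
  show ?case by (rule proper_bimodule_isomorphic[OF proper_regular_bimodule[OF p] zero])
next
  case (Suc n X Y)
  show ?case by (rule proper_bimodule_isomorphic[OF proper_strong_dual[OF Suc.IH] Suc.hyps(2)])
qed

lemma iterated_dual_unique:
  fixes X :: "('b::complex_algebra, 'u) bimodule" and Y :: "('b, 'v) bimodule"
  assumes "iterated_dual p n X" "iterated_dual p n Y" and p: "\<And>l. submultiplicative_seminorm (p l)"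
  shows "bimodule_isomorphic X Y"
  using assms(1,2)
proof (induction n X arbitrary: Y rule: iterated_dual.induct)
  case (zero X)
  from zero(2) have "bimodule_isomorphic (regular_bimodule p) Y" by cases
  then show ?case
    by (rule bimodule_isomorphic_trans[OF
          bimodule_isomorphic_sym[OF proper_regular_bimodule[OF p] zero(1)]])
next
  case (Suc n X X')
  from Suc.prems obtain Z :: "('b, 'v) bimodule" where Z: "iterated_dual p n Z" "bimodule_isomorphic (strong_dual Z) Y" by cases
  have X: "proper_bimodule X" by (rule proper_iterated_dual[OF Suc.hyps(1) p])
  have "bimodule_isomorphic (strong_dual X) (strong_dual Z)"
    by (rule bimodule_isomorphic_strong_dual[OF X Suc.IH[OF Z(1)]])
  then show ?case
    by (rule bimodule_isomorphic_trans[OF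
          bimodule_isomorphic_sym[OF proper_strong_dual[OF X] Suc.hyps(2)]
          bimodule_isomorphic_trans[OF _ Z(2)]])
qed

definition transport :: "('x \<Rightarrow> 'y) \<Rightarrow> ('b, 'x) bimodule \<Rightarrow> ('b, 'y) bimodule" where
  "transport j X =
     \<lparr>bcarrier = j ` bcarrier X, bzero = j (bzero X),
      badd = (\<lambda>x y. j (badd X (inv j x) (inv j y))),
      bscale = (\<lambda>c x. j (bscale X c (inv j x))),
      btop = topology (\<lambda>U. \<exists>V. openin (btop X) V \<and> U = j ` V),
      lact = (\<lambda>b x. j (lact X b (inv j x))),
      ract = (\<lambda>x b. j (ract X (inv j x) b))\<rparr>"

lemma bimodule_isomorphic_transport:
  assumes j: "inj j"
  shows "bimodule_isomorphic X (transport j X)"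
proof -
  have "istopology (\<lambda>U. \<exists>V. openin (btop X) V \<and> U = j ` V)"
    unfolding istopology_def
  proof (intro conjI allI impI)
    fix S T assume "\<exists>V. openin (btop X) V \<and> S = j ` V" "\<exists>V. openin (btop X) V \<and> T = j ` V"
    then obtain V W where "openin (btop X) V" "S = j ` V" "openin (btop X) W" "T = j ` W" by blast
    then show "\<exists>V. openin (btop X) V \<and> S \<inter> T = j ` V"
      by (intro exI[of _ "V \<inter> W"]) (simp add: image_Int[OF j] openin_Int)
  next
    fix K assume "\<forall>S\<in>K. \<exists>V. openin (btop X) V \<and> S = j ` V"
    then obtain V where V: "\<forall>S\<in>K. openin (btop X) (V S) \<and> S = j ` V S" by (auto dest: bchoice)
    then have "openin (btop X) (\<Union>(V ` K))" by auto
    moreover have "\<Union>K = j ` \<Union>(V ` K)" unfolding image_UN using V by simp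
    ultimately show "\<exists>V. openin (btop X) V \<and> \<Union>K = j ` V" by blast
  qed
  then have op: "openin (btop (transport j X)) U \<longleftrightarrow> (\<exists>V. openin (btop X) V \<and> U = j ` V)" for U
    by (simp add: transport_def topology_inverse')
  have tsp: "topspace (btop (transport j X)) = j ` topspace (btop X)"
  proof
    show "topspace (btop (transport j X)) \<subseteq> j ` topspace (btop X)"
      using op[THEN iffD1, OF openin_topspace] openin_subset by (metis image_mono)
    show "j ` topspace (btop X) \<subseteq> topspace (btop (transport j X))"
      by (rule openin_subset, rule op[THEN iffD2]) (use openin_topspace in blast)
  qed
  have "homeomorphic_map (btop X) (btop (transport j X)) j"
    unfolding homeomorphic_map_def quotient_map_def
  proof (intro conjI allI impI)
    show "j ` topspace (btop X) = topspace (btop (transport j X))" by (simp add: tsp)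
    show "inj_on j (topspace (btop X))" using j by (simp add: inj_on_def)
    fix U assume "U \<subseteq> topspace (btop (transport j X))"
    then have "U = j ` {x \<in> topspace (btop X). j x \<in> U}" by (auto simp: tsp)
    moreover have "{x \<in> topspace (btop X). j x \<in> j ` V} = V" if "openin (btop X) V" for V
      using openin_subset[OF that] by (auto simp: inj_image_mem_iff[OF j])
    ultimately show "openin (btop X) {x \<in> topspace (btop X). j x \<in> U} =
        openin (btop (transport j X)) U"
      unfolding op by metis
  qed
  moreover have "bij_betw j (bcarrier X) (bcarrier (transport j X))"
    using j by (auto simp: transport_def bij_betw_def inj_on_def)
  ultimately have "bimodule_isomorphism X (transport j X) j"
    using j by (simp add: bimodule_isomorphism_def transport_def)
  then show ?thesis by (auto simp: bimodule_isomorphic_def)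
qed

lemma iterated_dual_transport:
  assumes "iterated_dual p n X" and j: "inj j" and p: "\<And>l. submultiplicative_seminorm (p l)"
  shows "iterated_dual p n (transport j X)"
  using assms(1)
proof induction
  case (zero X)
  then show ?case
    by (meson bimodule_isomorphic_transport[OF j] bimodule_isomorphic_trans iterated_dual.zero)
next
  case (Suc n X Y)
  have X: "proper_bimodule X" by (rule proper_iterated_dual[OF Suc.hyps(1) p])
  have "bimodule_isomorphic (strong_dual X) (strong_dual (transport j X))"
    by (rule bimodule_isomorphic_strong_dual[OF X bimodule_isomorphic_transport[OF j]])
  then have "bimodule_isomorphic (strong_dual (transport j X)) (transport j Y)"
    by (rule bimodule_isomorphic_trans[OF
          bimodule_isomorphic_sym[OF proper_strong_dual[OF X]]
          bimodule_isomorphic_trans[OF Suc.hyps(2) bimodule_isomorphic_transport[OF j]]])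
  then show ?case by (rule iterated_dual.Suc[OF Suc.IH])
qed

lemma iterated_dual_regular_bimodule: "iterated_dual p 0 (regular_bimodule p)"
proof -
  have "bimodule_isomorphism (regular_bimodule p) (regular_bimodule p) id"
    by (simp add: bimodule_isomorphism_def homeomorphic_map_id)
  then show ?thesis
    using iterated_dual.zero bimodule_isomorphic_def by blast
qed

lemma iterated_dual_strong_dual:
  fixes X :: "('b::complex_algebra, 'u) bimodule"
  assumes X: "iterated_dual p n X" and p: "\<And>l. submultiplicative_seminorm (p l)"
  shows "iterated_dual p (Suc n) (strong_dual X)"
proof -
  define j :: "'u \<Rightarrow> 'u \<Rightarrow> complex" where "j u = (\<lambda>v. if v = u then 1 else 0)" for u
  have j: "inj j" by (rule injI) (metis j_def zero_neq_one)
  note X' = proper_iterated_dual[OF X p]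
  show ?thesis
    by (rule iterated_dual.Suc[OF iterated_dual_transport[OF X j p]],
        rule bimodule_isomorphic_sym[OF proper_strong_dual[OF X']],
        rule bimodule_isomorphic_strong_dual[OF X' bimodule_isomorphic_transport[OF j]])
qed

lemma has_iterated_dual_0:
  fixes p :: "nat \<Rightarrow> 'b::complex_algebra \<Rightarrow> real"
  shows "has_iterated_dual TYPE('b) 0 p"
  unfolding has_iterated_dual_def using iterated_dual_regular_bimodule by blast

lemma has_iterated_dual_Suc:
  assumes "has_iterated_dual TYPE('u) n p" and p: "\<And>l. submultiplicative_seminorm (p l)"
  shows "has_iterated_dual TYPE('u \<Rightarrow> complex) (Suc n) p"
proof -
  obtain X :: "('a, 'u) bimodule" where "iterated_dual p n X"
    using assms(1) by (auto simp: has_iterated_dual_def)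
  then have "iterated_dual p (Suc n) (strong_dual X)" by (rule iterated_dual_strong_dual[OF _ p])
  then show ?thesis by (auto simp: has_iterated_dual_def)
qed

lemma inner_derivations_isomorphic:
  assumes X: "proper_bimodule X" and XY: "bimodule_isomorphic X Y"
    and inner: "\<And>D. continuous_derivation p X D \<Longrightarrow> inner_derivation X D"
    and D: "continuous_derivation p Y D"
  shows "inner_derivation Y D"
proof -
  obtain \<phi> where iso: "bimodule_isomorphism X Y \<phi>" using XY by (auto simp: bimodule_isomorphic_def)
  define \<psi> where "\<psi> = inv_into (bcarrier X) \<phi>"
  have iso': "bimodule_isomorphism Y X \<psi>" unfolding \<psi>_def by (rule bimodule_isomorphism_sym[OF X iso])
  have bij: "bij_betw \<phi> (bcarrier X) (bcarrier Y)" using iso by (simp add: bimodule_isomorphism_def)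
  have \<phi>\<psi>: "\<phi> (\<psi> y) = y" if "y \<in> bcarrier Y" for y
    using bij_betw_inv_into_right[OF bij that] by (simp add: \<psi>_def)
  have Y: "proper_bimodule Y" by (rule proper_bimodule_isomorphic[OF X XY])
  have "continuous_map (algebra_topology p) (btop X) (\<psi> \<circ> D)"
  proof (rule continuous_map_compose)
    show "continuous_map (algebra_topology p) (btop Y) D"
      using D by (simp add: continuous_derivation_def)
    show "continuous_map (btop Y) (btop X) \<psi>"
      using iso' by (simp add: bimodule_isomorphism_def homeomorphic_imp_continuous_map)
  qed
  then have "continuous_derivation p X (\<psi> \<circ> D)"
    using D iso' bimodule_isomorphism_image[OF iso'] Y
    by (auto simp: continuous_derivation_def bimodule_isomorphism_def
        proper_bimodule.lact_closed proper_bimodule.ract_closed)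
  then obtain x where x: "x \<in> bcarrier X"
    "\<And>b. \<psi> (D b) = badd X (lact X b x) (bscale X (-1) (ract X x b))"
    using inner[of "\<psi> \<circ> D"] unfolding inner_derivation_def o_def by blast
  have "D b = badd Y (lact Y b (\<phi> x)) (bscale Y (-1) (ract Y (\<phi> x) b))" for b
  proof -
    have "D b = \<phi> (badd X (lact X b x) (bscale X (-1) (ract X x b)))"
      using \<phi>\<psi>[of "D b"] D x(2)[of b] by (simp add: continuous_derivation_def)
    then show ?thesis
      using iso x(1) X by (simp add: bimodule_isomorphism_def proper_bimodule.lact_closed
          proper_bimodule.ract_closed proper_bimodule.bscale_closed)
  qed
  then show ?thesis
    using bimodule_isomorphism_image[OF iso x(1)] by (auto simp: inner_derivation_def)
qed

lemma n_weakly_amenable_iff: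
  fixes X :: "('b::complex_algebra, 'v) bimodule"
  assumes X: "iterated_dual p n X" and p: "\<And>l. submultiplicative_seminorm (p l)"
    and u: "has_iterated_dual TYPE('u) n p"
  shows "n_weakly_amenable TYPE('u) n p \<longleftrightarrow>
    (\<forall>D. continuous_derivation p X D \<longrightarrow> inner_derivation X D)"
proof (intro iffI allI impI)
  fix D assume n: "n_weakly_amenable TYPE('u) n p" and D: "continuous_derivation p X D"
  obtain Y :: "('b, 'u) bimodule" where Y: "iterated_dual p n Y"
    using u by (auto simp: has_iterated_dual_def)
  have inner: "inner_derivation Y D" if "continuous_derivation p Y D" for D
    using n Y that unfolding n_weakly_amenable_def by blast
  show "inner_derivation X D"
    by (rule inner_derivations_isomorphic[OF proper_iterated_dual[OF Y p]
          iterated_dual_unique[OF Y X p] inner D])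
next
  assume *: "\<forall>D. continuous_derivation p X D \<longrightarrow> inner_derivation X D"
  show "n_weakly_amenable TYPE('u) n p"
    unfolding n_weakly_amenable_def
  proof (intro allI impI)
    fix Y :: "('b, 'u) bimodule" and D
    assume Y: "iterated_dual p n Y" and D: "continuous_derivation p Y D"
    show "inner_derivation Y D"
      by (rule inner_derivations_isomorphic[OF proper_iterated_dual[OF X p]
            iterated_dual_unique[OF X Y p] *[rule_format] D])
  qed
qed

lemma weakly_amenable_iff:
  assumes p: "\<And>l. submultiplicative_seminorm (p l)" and u: "has_iterated_dual TYPE('u) 1 p"
  shows "weakly_amenable p \<longleftrightarrow> n_weakly_amenable TYPE('u) 1 p"
proof -
  have "iterated_dual p 1 (strong_dual (regular_bimodule p))"
    using iterated_dual_strong_dual[OF iterated_dual_regular_bimodule p] by simp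
  from n_weakly_amenable_iff[OF this p u] show ?thesis by (simp add: weakly_amenable_def)
qed

end

theory Submission
  imports Defs
begin

text \<open>The even duals of \<open>A\<^sup>#\<close> are \<open>A\<^sup>(\<^sup>2\<^sup>n\<^sup>) \<oplus> \<complex>\<close> with \<open>(b, \<beta>) (F, \<nu>) = (b F + \<beta> F + \<nu> \<iota>(b), \<nu> \<beta>)\<close>, where \<open>\<iota>\<close> is the
  canonical embedding of \<open>A\<close>, and symmetrically on the right. Hence a derivation \<open>D\<close> of \<open>A\<^sup>#\<close> kills
  \<open>e\<close>, its scalar component \<open>f\<close> is a continuous functional on \<open>A\<close> that vanishes on products, and
  once \<open>f = 0\<close> the other component is a derivation of \<open>A\<close>. Implementing elements correspond
  because the terms \<open>\<beta> F + \<nu> \<iota>(b)\<close> cancel in commutators. To see that \<open>f = 0\<close>, note that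
  \<open>a \<mapsto> f(a) f\<close> is a derivation into \<open>A\<^sup>*\<close>, with both products with \<open>A\<close> zero; by weak amenability
  it is inner, so that \<open>f(a)\<^sup>2 = g(a a - a a) = 0\<close> for some \<open>g\<close>.\<close>

section \<open>Continuity for topologies generated by seminorms\<close>

text \<open>The topology is generated by balls, and the preimage of a ball is the preimage of a ray
  under \<open>q (g z - x)\<close>. The two range conditions are separate because the underlying set
  of \<open>seminorm_topology V Q\<close> is the union of the balls, which may be smaller than
  \<open>V\<close>.\<close>

lemma continuous_map_into_seminorm_topology:
  assumes g: "g ` topspace Z \<subseteq> topspace (seminorm_topology V Q)"
    and V: "g ` topspace Z \<subseteq> V"
    and q: "\<And>q x. q \<in> Q \<Longrightarrow> x \<in> V \<Longrightarrow> continuous_map Z euclideanreal (\<lambda>z. q (g z - x))"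
  shows "continuous_map Z (seminorm_topology V Q) g"
  unfolding seminorm_topology_def
proof (rule continuous_on_generated_topo)
  show "g ` topspace Z \<subseteq> \<Union>{{y \<in> V. q (y - x) < r} |q x r. q \<in> Q \<and> x \<in> V \<and> 0 < r}"
    using g by (simp only: seminorm_topology_def topology_generated_by_topspace)
  fix U assume "U \<in> {{y \<in> V. q (y - x) < r} |q x r. q \<in> Q \<and> x \<in> V \<and> 0 < r}"
  then obtain q x r where U: "U = {y \<in> V. q (y - x) < r}" "q \<in> Q" "x \<in> V" by blast
  have "openin Z {z \<in> topspace Z. q (g z - x) \<in> {..<r}}"
    by (rule openin_continuous_map_preimage[OF q[OF U(2,3)]]) simp
  moreover have "g -` U \<inter> topspace Z = {z \<in> topspace Z. q (g z - x) \<in> {..<r}}"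
    using V by (auto simp: U(1))
  ultimately show "openin Z (g -` U \<inter> topspace Z)" by simp
qed

text \<open>A single \<open>q\<close> that dominates the variation of \<open>h\<close> is enough:
  the \<open>q\<close>-ball of radius \<open>e\<close> about a point is mapped into the metric ball
  of radius \<open>e\<close>. The condition \<open>q0\<close> puts each point into its own
  ball.\<close>

lemma continuous_map_from_seminorm_topology:
  fixes h :: "'x::minus \<Rightarrow> 'm::metric_space"
  assumes q: "q \<in> Q" and q0: "\<And>x. x \<in> V \<Longrightarrow> q (x - x) = 0"
    and lip: "\<And>x y. x \<in> V \<Longrightarrow> y \<in> V \<Longrightarrow> dist (h x) (h y) \<le> q (x - y)"
  shows "continuous_map (seminorm_topology V Q) euclidean h"
proof -
  let ?T = "seminorm_topology V Q"
  have V: "topspace ?T \<subseteq> V"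
    unfolding seminorm_topology_def topology_generated_by_topspace by blast
  have "openin ?T {x \<in> topspace ?T. h x \<in> U}" if U: "open U" for U
  proof (subst openin_subopen, intro ballI)
    fix x assume x: "x \<in> {x \<in> topspace ?T. h x \<in> U}"
    then obtain e where e: "e > 0" "\<And>m. dist m (h x) < e \<Longrightarrow> m \<in> U"
      using U by (auto simp: open_dist)
    define W where "W = {y \<in> V. q (y - x) < e}"
    have "openin ?T W"
      unfolding seminorm_topology_def W_def
      by (rule topology_generated_by_Basis) (use q x V e(1) in blast)
    moreover have "x \<in> W" using x V e(1) q0 by (auto simp: W_def)
    moreover have "W \<subseteq> {x \<in> topspace ?T. h x \<in> U}"
    proof
      fix y assume y: "y \<in> W"
      have "dist (h y) (h x) < e" using lip[of y x] x y V by (auto simp: W_def)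
      then show "y \<in> {x \<in> topspace ?T. h x \<in> U}"
        using y e(2) openin_subset[OF \<open>openin ?T W\<close>] by auto
    qed
    ultimately show "\<exists>W. openin ?T W \<and> x \<in> W \<and> W \<subseteq> {x \<in> topspace ?T. h x \<in> U}" by blast
  qed
  then show ?thesis by (simp add: continuous_map)
qed

section \<open>Scalar multiplication and seminorm inequalities\<close>

lemma scaleC_zero_left: "0 *\<^sub>C (x::'a::complex_algebra) = 0"
  using scaleC_add_left[of 0 0 x] by simp

lemma scaleC_zero_right: "c *\<^sub>C (0::'a::complex_algebra) = 0"
  using scaleC_add_right[of c 0 "0::'a"] by simp

lemma scaleC_diff_left: "(c - d) *\<^sub>C (x::'a::complex_algebra) = c *\<^sub>C x - d *\<^sub>C x"
  using scaleC_add_left[of "c - d" d x] by simp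

lemma submultiplicative_seminormD:
  assumes "submultiplicative_seminorm q"
  shows "0 \<le> q x" "q (x + y) \<le> q x + q y" "q (c *\<^sub>C x) = cmod c * q x" "q 0 = 0"
    "\<bar>q x - q y\<bar> \<le> q (x - y)"
proof -
  show add: "q (x + y) \<le> q x + q y" and scale: "q (c *\<^sub>C x) = cmod c * q x" and "0 \<le> q x" for x y c
    using assms by (simp_all add: submultiplicative_seminorm_def)
  show "q 0 = 0" using scale[of 0 0] by (simp add: scaleC_zero_left)
  \<comment> \<open>Scaling by -1 is negation, so homogeneity of \<open>q\<close> yields the
    symmetry that the reverse triangle inequality needs.\<close>
  have "(-1) *\<^sub>C x + x = 0" for x :: 'a
    using scaleC_add_left[of "-1" 1 x] by (simp add: scaleC_one scaleC_zero_left)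
  then have "q (y - x) = q (x - y)"
    using scale[of "-1" "x - y"] by (metis add_eq_0_iff minus_diff_eq mult_1 norm_minus_cancel norm_one add.commute)
  then show "\<bar>q x - q y\<bar> \<le> q (x - y)"
    using add[of "x - y" y] add[of "y - x" x] by simp
qed

lemma topspace_algebra_topology:
  fixes p :: "nat \<Rightarrow> 'a::complex_algebra \<Rightarrow> real"
  assumes "\<And>l. submultiplicative_seminorm (p l)"
  shows "topspace (algebra_topology p) = UNIV"
  using proper_bimodule.topspace_btop[OF proper_regular_bimodule[OF assms]]
  by (simp add: regular_bimodule_def)

section \<open>Bounded points and point evaluations\<close>

text \<open>A functional is bounded on every bounded set \<open>S\<close>, so the distance of
  \<open>c f\<close> to \<open>g\<close>, measured uniformly on \<open>S\<close>, is Lipschitz in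
  \<open>c\<close> with constant the supremum of |f| on \<open>S\<close>. This serves twice: for
  boundedness of points of the dual, and for continuity of the rank-one derivation below.\<close>

lemma continuous_map_bscale_strong_dual:
  assumes X: "proper_bimodule X" and f: "f \<in> continuous_functionals X"
  shows "continuous_map euclidean (btop (strong_dual X)) (\<lambda>c x. c * f x)"
proof -
  have cl: "(\<lambda>x. c * f x) \<in> continuous_functionals X" for c
    using proper_bimodule.bscale_closed[OF proper_strong_dual[OF X], of f c] f by simp
  have top: "btop (strong_dual X) = seminorm_topology (continuous_functionals X)
      {\<lambda>f. SUP x\<in>S. cmod (f x) |S. bounded_in X S \<and> S \<noteq> {}}"
    by (simp add: strong_dual_def)
  show ?thesis
    unfolding top
  proof (rule continuous_map_into_seminorm_topology)
    show "(\<lambda>c x. c * f x) ` topspace euclidean \<subseteq> topspace (seminorm_topology (continuous_functionals X)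
        {\<lambda>f. SUP x\<in>S. cmod (f x) |S. bounded_in X S \<and> S \<noteq> {}})"
      unfolding top[symmetric] topspace_strong_dual[OF X] using cl by auto
    show "(\<lambda>c x. c * f x) ` topspace euclidean \<subseteq> continuous_functionals X" using cl by auto
    fix q g assume "q \<in> {\<lambda>f. SUP x\<in>S. cmod (f x) |S. bounded_in X S \<and> S \<noteq> {}}"
      and g: "g \<in> continuous_functionals X"
    then obtain S where S: "bounded_in X S" "S \<noteq> {}" and q: "q = (\<lambda>f. SUP x\<in>S. cmod (f x))"
      by blast
    define h where "h c = q ((\<lambda>x. c * f x) - g)" for c
    have bf: "cmod (f x) \<le> q f" if "x \<in> S" for x
      unfolding q by (rule cSUP_upper[OF that bdd_above_functional[OF X f S(1)]])
    have le: "h c \<le> h d + q f * cmod (c - d)" for c d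
    proof -
      have "cmod (((\<lambda>x. c * f x) - g) x) \<le> h d + q f * cmod (c - d)" if x: "x \<in> S" for x
      proof -
        have "((\<lambda>x. c * f x) - g) x = ((\<lambda>x. d * f x) - g) x + (c - d) * f x"
          by (simp add: algebra_simps)
        then have "cmod (((\<lambda>x. c * f x) - g) x) \<le>
            cmod (((\<lambda>x. d * f x) - g) x) + cmod (c - d) * cmod (f x)"
          by (metis norm_triangle_ineq norm_mult)
        moreover have "cmod (((\<lambda>x. d * f x) - g) x) \<le> h d"
          unfolding h_def q
          by (rule cSUP_upper[OF x bdd_above_functional[OF X diff_continuous_functional[OF cl g] S(1)]])
        moreover have "cmod (c - d) * cmod (f x) \<le> cmod (c - d) * q f"
          by (intro mult_left_mono bf x) simp
        ultimately show ?thesis by (simp add: mult.commute)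
      qed
      then show ?thesis unfolding h_def[of c] by (subst q) (rule cSUP_least[OF S(2)])
    qed
    have "dist (h c) (h d) \<le> q f * dist c d" for c d
      using le[of c d] le[of d c] by (simp add: dist_norm norm_minus_commute abs_le_iff)
    \<comment> \<open>A Lipschitz constant has to be nonnegative; a point of the nonempty set
      \<open>S\<close> shows this for \<open>q f\<close>.\<close>
    moreover obtain x where "x \<in> S" using S(2) by blast
    then have "0 \<le> q f" using bf[of x] order_trans[OF norm_ge_zero] by blast
    ultimately have "(q f)-lipschitz_on UNIV h" by (intro lipschitz_onI)
    then show "continuous_map euclidean euclideanreal (\<lambda>c. q ((\<lambda>x. c * f x) - g))"
      using lipschitz_on_continuous_on by (auto simp: h_def[abs_def])
  qed
qed

text \<open>Continuity of \<open>c \<mapsto> c x\<close> at 0 says that every neighbourhood of zero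
  absorbs \<open>x\<close>. The raw bimodule structure carries no module axioms, so the scalar
  identities enter as premises.\<close>

lemma bounded_in_point:
  assumes "continuous_map euclidean (btop X) (\<lambda>c. bscale X c x)"
    and "x \<in> bcarrier X" "bscale X 0 x = bzero X"
    and inv: "\<And>c. c \<noteq> 0 \<Longrightarrow> bscale X c (bscale X (inverse c) x) = x"
  shows "bounded_in X {x}"
  unfolding bounded_in_def
proof (intro conjI allI impI)
  show "{x} \<subseteq> bcarrier X" using assms by simp
  fix U assume U: "openin (btop X) U \<and> bzero X \<in> U"
  have "open {c. bscale X c x \<in> U}"
    using openin_continuous_map_preimage[OF assms(1), of U] U by simp
  moreover have "0 \<in> {c. bscale X c x \<in> U}" using U assms(3) by simp
  ultimately obtain e where e: "e > 0" "\<And>c. cmod c < e \<Longrightarrow> bscale X c x \<in> U"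
    by (force simp: open_dist)
  \<comment> \<open>The threshold \<open>2 / e\<close> rather than \<open>1 / e\<close> makes |1/c|
    < e strict.\<close>
  have "{x} \<subseteq> bscale X c ` U" if c: "2 / e \<le> cmod c" for c
  proof -
    have "cmod c > 0" using c e(1) by (meson divide_pos_pos less_le_trans zero_less_numeral)
    moreover have "1 < e * cmod c"
      using c e(1) by (simp add: field_simps)
    ultimately have "c \<noteq> 0" "cmod (inverse c) < e"
      by (auto simp: norm_inverse norm_divide field_simps)
    then show ?thesis using e(2)[of "inverse c"] inv[of c] by (force simp: image_iff)
  qed
  then show "\<exists>r>0. \<forall>c. r \<le> cmod c \<longrightarrow> {x} \<subseteq> bscale X c ` U"
    using e(1) by (intro exI[of _ "2 / e"]) auto
qed

text \<open>The canonical image of \<open>x\<close> in the bidual; the value 0 off the dual is the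
  extensionality that \<open>continuous_functionals\<close> demands.\<close>

definition evaluation :: "('b, 'x) bimodule \<Rightarrow> 'x \<Rightarrow> ('x \<Rightarrow> complex) \<Rightarrow> complex" where
  "evaluation X x f = (if f \<in> continuous_functionals X then f x else 0)"

text \<open>As \<open>{x}\<close> is bounded, |f(x)| is one of the seminorms that generate the
  strong topology, and the evaluation is 1-Lipschitz for it.\<close>

lemma evaluation_closed:
  assumes X: "proper_bimodule X" and x: "bounded_in X {x}"
  shows "evaluation X x \<in> continuous_functionals (strong_dual X)"
proof -
  have "continuous_map (btop (strong_dual X)) euclidean (evaluation X x)"
    unfolding strong_dual_def bimodule.simps
  proof (rule continuous_map_from_seminorm_topology)
    show "(\<lambda>f. SUP y\<in>{x}. cmod (f y)) \<in> {\<lambda>f. SUP x\<in>S. cmod (f x) |S. bounded_in X S \<and> S \<noteq> {}}"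
      using x by blast
  qed (auto simp: evaluation_def dist_norm)
  moreover have "(\<lambda>y. f y + g y) \<in> continuous_functionals X" "(\<lambda>y. c * f y) \<in> continuous_functionals X"
    if "f \<in> continuous_functionals X" "g \<in> continuous_functionals X" for f g c
    using proper_bimodule.badd_closed[OF proper_strong_dual[OF X], of f g]
      proper_bimodule.bscale_closed[OF proper_strong_dual[OF X], of f c] that by simp_all
  ultimately show ?thesis
    unfolding continuous_functionals_def[of "strong_dual X"] by (auto simp: evaluation_def)
qed

text \<open>\<^const>\<open>proper_bimodule\<close> requires neither linearity of the actions in the algebra variable
  nor continuity of \<open>c \<mapsto> c x\<close>. The following consequences of these hold in all iterated duals.\<close>

locale tame_bimodule = proper_bimodule X for X :: "('b::complex_algebra, 'x) bimodule" +
  assumes bounded_point: "x \<in> bcarrier X \<Longrightarrow> bounded_in X {x}"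
    and lact_0: "x \<in> bcarrier X \<Longrightarrow> lact X 0 x = bzero X"
    and ract_0: "x \<in> bcarrier X \<Longrightarrow> ract X x 0 = bzero X"

lemma functional_simps:
  assumes "proper_bimodule X" "f \<in> continuous_functionals X"
  shows "x \<in> bcarrier X \<Longrightarrow> y \<in> bcarrier X \<Longrightarrow> f (badd X x y) = f x + f y"
    "x \<in> bcarrier X \<Longrightarrow> f (bscale X c x) = c * f x" "f (bzero X) = 0"
proof -
  show "x \<in> bcarrier X \<Longrightarrow> y \<in> bcarrier X \<Longrightarrow> f (badd X x y) = f x + f y"
    and *: "\<And>c x. x \<in> bcarrier X \<Longrightarrow> f (bscale X c x) = c * f x"
    using assms(2) by (simp_all add: continuous_functionals_def)
  show "f (bzero X) = 0"
    using *[of "bzero X" 0] assms(1) by (simp add: proper_bimodule.bscale_0 proper_bimodule.bzero_closed)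
qed

text \<open>Points are bounded because their scalar orbits are continuous; 0 acts as zero on
  \<open>f\<close> because it does so on \<open>X\<close> and \<open>f\<close> vanishes at
  \<open>bzero X\<close>.\<close>

lemma tame_strong_dual:
  assumes "tame_bimodule X"
  shows "tame_bimodule (strong_dual X)"
proof -
  interpret tame_bimodule X by fact
  have X: "proper_bimodule X" by unfold_locales
  show ?thesis
  proof (intro tame_bimodule.intro tame_bimodule_axioms.intro)
    show "proper_bimodule (strong_dual X)" by (rule proper_strong_dual[OF X])
    fix f assume f: "f \<in> bcarrier (strong_dual X)"
    show "bounded_in (strong_dual X) {f}"
      by (rule bounded_in_point) (use f continuous_map_bscale_strong_dual[OF X] in auto)
    have "f (bzero X) = 0" using functional_simps[OF X] f by simp
    then show "lact (strong_dual X) 0 f = bzero (strong_dual X)"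
      "ract (strong_dual X) f 0 = bzero (strong_dual X)"
      by (auto simp: pullback_def lact_0 ract_0)
  qed
qed

lemma bimodule_isomorphism_linear:
  "bimodule_isomorphism X Y \<phi> \<Longrightarrow> continuous_linear X Y \<phi>"
  by (simp add: bimodule_isomorphism_def continuous_linear_def homeomorphic_imp_continuous_map)

lemma tame_isomorphic:
  assumes "tame_bimodule X" and XY: "bimodule_isomorphic X Y"
  shows "tame_bimodule Y"
proof -
  interpret tame_bimodule X by fact
  have X: "proper_bimodule X" by unfold_locales
  have Y: "proper_bimodule Y" by (rule proper_bimodule_isomorphic[OF X XY])
  obtain \<phi> where iso: "bimodule_isomorphism X Y \<phi>" using XY by (auto simp: bimodule_isomorphic_def)
  then have "bij_betw \<phi> (bcarrier X) (bcarrier Y)" by (simp add: bimodule_isomorphism_def)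
  then have ex: "\<exists>x\<in>bcarrier X. y = \<phi> x" if "y \<in> bcarrier Y" for y
    using that by (auto simp: bij_betw_def)
  show ?thesis
  proof (intro tame_bimodule.intro tame_bimodule_axioms.intro Y)
    fix y assume "y \<in> bcarrier Y"
    then obtain x where x: "x \<in> bcarrier X" "y = \<phi> x" using ex by blast
    show "bounded_in Y {y}"
      using bounded_in_image[OF X Y bimodule_isomorphism_linear[OF iso] bounded_point[OF x(1)]] x(2)
      by simp
    show "lact Y 0 y = bzero Y" "ract Y y 0 = bzero Y"
      using iso x lact_0[OF x(1)] ract_0[OF x(1)] unfolding bimodule_isomorphism_def by metis+
  qed
qed

lemma tame_regular_bimodule:
  fixes p :: "nat \<Rightarrow> 'a::complex_algebra \<Rightarrow> real"
  assumes p: "\<And>l. submultiplicative_seminorm (p l)"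
  shows "tame_bimodule (regular_bimodule p)"
proof (intro tame_bimodule.intro tame_bimodule_axioms.intro)
  show "proper_bimodule (regular_bimodule p)" by (rule proper_regular_bimodule[OF p])
  fix x :: 'a
  have "continuous_map euclidean (algebra_topology p) (\<lambda>c. c *\<^sub>C x)"
    unfolding algebra_topology_def
  proof (rule continuous_map_into_seminorm_topology)
    show "(\<lambda>c. c *\<^sub>C x) ` topspace euclidean \<subseteq> topspace (seminorm_topology UNIV (range p))"
      using topspace_algebra_topology[OF p] by (simp add: algebra_topology_def)
    fix q y assume "q \<in> range p"
    then obtain l where q: "q = p l" by blast
    note q_simps = submultiplicative_seminormD[OF p[of l], folded q]
    \<comment> \<open>The reverse triangle inequality bounds this by
      \<open>q ((c - d) *\<^sub>C x)\<close>.\<close>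
    have "dist (q (c *\<^sub>C x - y)) (q (d *\<^sub>C x - y)) \<le> q x * dist c d" for c d
      using q_simps(5)[of "c *\<^sub>C x - y" "d *\<^sub>C x - y"] q_simps(3)[of "c - d" x]
      by (simp add: dist_norm scaleC_diff_left mult.commute)
    then have "(q x)-lipschitz_on UNIV (\<lambda>c. q (c *\<^sub>C x - y))"
      using q_simps(1) by (intro lipschitz_onI)
    then show "continuous_map euclidean euclideanreal (\<lambda>c. q (c *\<^sub>C x - y))"
      using lipschitz_on_continuous_on by auto
  qed simp
  then show "bounded_in (regular_bimodule p) {x}"
    by (intro bounded_in_point)
      (simp_all add: regular_bimodule_def scaleC_zero_left scaleC_scaleC scaleC_one)
qed (simp_all add: regular_bimodule_def)

section \<open>Bimodules over the unitization\<close>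

text \<open>Restriction of scalars along \<open>b \<mapsto> (b, 0)\<close>. It puts modules over the
  algebra and over its unitization under one algebra type, as \<open>continuous_linear\<close>
  requires.\<close>

definition restriction :: "('a::complex_algebra unitization, 'y) bimodule \<Rightarrow> ('a, 'y) bimodule" where
  "restriction Y =
     \<lparr>bcarrier = bcarrier Y, bzero = bzero Y, badd = badd Y, bscale = bscale Y, btop = btop Y,
      lact = (\<lambda>b. lact Y (Unitization b 0)), ract = (\<lambda>y b. ract Y y (Unitization b 0))\<rparr>"

lemma restriction_simps [simp]:
  "bcarrier (restriction Y) = bcarrier Y"
  "bzero (restriction Y) = bzero Y"
  "badd (restriction Y) = badd Y"
  "bscale (restriction Y) = bscale Y"
  "btop (restriction Y) = btop Y"
  "lact (restriction Y) b = lact Y (Unitization b 0)"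
  "ract (restriction Y) y b = ract Y y (Unitization b 0)"
  by (simp_all add: restriction_def)

lemma proper_restriction: "proper_bimodule Y \<Longrightarrow> proper_bimodule (restriction Y)"
  by (simp add: proper_bimodule_def)

lemma continuous_functionals_restriction [simp]:
  "continuous_functionals (restriction Y) = continuous_functionals Y"
  by (simp add: continuous_functionals_def)

lemma pullback_restriction [simp]: "pullback (restriction Y) = pullback Y"
  by (simp add: pullback_def fun_eq_iff)

text \<open>This is an equality and not just an isomorphism: functionals and bounded sets do not
  depend on the actions.\<close>

lemma restriction_strong_dual: "restriction (strong_dual Y) = strong_dual (restriction Y)"
proof -
  have "bounded_in (restriction Y) S \<longleftrightarrow> bounded_in Y S" for S by (simp add: bounded_in_def)
  then have "btop (restriction (strong_dual Y)) = btop (strong_dual (restriction Y))"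
    by (simp add: strong_dual_def)
  moreover have "lact (restriction (strong_dual Y)) = lact (strong_dual (restriction Y))"
    "ract (restriction (strong_dual Y)) = ract (strong_dual (restriction Y))"
    by (intro ext, simp)+
  ultimately show ?thesis by (intro bimodule.equality) simp_all
qed

lemma bimodule_isomorphism_restriction:
  "bimodule_isomorphism Y Y' \<psi> \<Longrightarrow> bimodule_isomorphism (restriction Y) (restriction Y') \<psi>"
  by (simp add: bimodule_isomorphism_def)

lemma continuous_linear_pullback:
  assumes "proper_bimodule X" "proper_bimodule Y" "continuous_linear X Y T"
  shows "continuous_linear (strong_dual Y) (strong_dual X) (pullback X T)"
  using pullback_continuous[OF assms] by (auto simp: continuous_linear_def pullback_def)

lemma continuous_linear_compose:
  assumes "proper_bimodule X" "proper_bimodule Y"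
    and "continuous_linear X Y T" "continuous_linear Y Z S"
  shows "continuous_linear X Z (S \<circ> T)"
  using assms continuous_linear_closed[OF assms(1-3)] continuous_map_compose[of "btop X" "btop Y" T "btop Z" S]
  by (simp add: continuous_linear_def)

text \<open>\<open>Y\<close> is \<open>X \<oplus> \<complex>u\<close> with coordinates \<open>\<pi>\<close> and \<open>\<sigma>\<close>. The correction terms \<open>\<iota>\<close> and \<open>\<epsilon>\<close> in the action
  are interchanged by taking duals: \<open>\<epsilon>\<close> vanishes in the even and \<open>\<iota>\<close> in the odd iterated duals.\<close>

locale unitization_bimodule = X: tame_bimodule X + Y: tame_bimodule Y
  for X :: "('a::complex_algebra, 'x) bimodule" and Y :: "('a unitization, 'y) bimodule" +
  fixes j :: "'x \<Rightarrow> 'y" and \<pi> :: "'y \<Rightarrow> 'x" and \<sigma> :: "'y \<Rightarrow> complex" and u :: 'y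
    and \<iota> :: "'a \<Rightarrow> 'x" and \<epsilon> :: "'a \<Rightarrow> 'x \<Rightarrow> complex"
  assumes j: "continuous_linear X (restriction Y) j"
    and \<pi>: "continuous_linear (restriction Y) X \<pi>"
    and \<sigma>: "\<sigma> \<in> continuous_functionals Y"
    and u: "u \<in> bcarrier Y"
    and \<iota>: "\<iota> b \<in> bcarrier X"
    and \<epsilon>: "\<epsilon> b \<in> continuous_functionals X"
    and \<pi>_j: "x \<in> bcarrier X \<Longrightarrow> \<pi> (j x) = x"
    and \<sigma>_j: "x \<in> bcarrier X \<Longrightarrow> \<sigma> (j x) = 0"
    and \<pi>_u: "\<pi> u = bzero X"
    and \<sigma>_u: "\<sigma> u = 1"
    and decomposition: "y \<in> bcarrier Y \<Longrightarrow> badd Y (j (\<pi> y)) (bscale Y (\<sigma> y) u) = y"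
    and \<pi>_lact: "y \<in> bcarrier Y \<Longrightarrow> \<pi> (lact Y (Unitization b \<beta>) y) =
      badd X (badd X (lact X b (\<pi> y)) (bscale X \<beta> (\<pi> y))) (bscale X (\<sigma> y) (\<iota> b))"
    and \<pi>_ract: "y \<in> bcarrier Y \<Longrightarrow> \<pi> (ract Y y (Unitization b \<beta>)) =
      badd X (badd X (ract X (\<pi> y) b) (bscale X \<beta> (\<pi> y))) (bscale X (\<sigma> y) (\<iota> b))"
    and \<sigma>_lact: "y \<in> bcarrier Y \<Longrightarrow> \<sigma> (lact Y (Unitization b \<beta>) y) = \<epsilon> b (\<pi> y) + \<beta> * \<sigma> y"
    and \<sigma>_ract: "y \<in> bcarrier Y \<Longrightarrow> \<sigma> (ract Y y (Unitization b \<beta>)) = \<epsilon> b (\<pi> y) + \<beta> * \<sigma> y"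
begin

lemma proper: "proper_bimodule X" "proper_bimodule Y" "proper_bimodule (restriction Y)"
  by (rule X.proper_bimodule_axioms Y.proper_bimodule_axioms
      proper_restriction[OF Y.proper_bimodule_axioms])+

lemma j_closed: "x \<in> bcarrier X \<Longrightarrow> j x \<in> bcarrier Y"
  using continuous_linear_closed[OF proper(1,3) j] by simp

lemma \<pi>_closed: "y \<in> bcarrier Y \<Longrightarrow> \<pi> y \<in> bcarrier X"
  using continuous_linear_closed[OF proper(3,1) \<pi>] by simp

lemma \<pi>_linear:
  "y \<in> bcarrier Y \<Longrightarrow> z \<in> bcarrier Y \<Longrightarrow> \<pi> (badd Y y z) = badd X (\<pi> y) (\<pi> z)"
  "y \<in> bcarrier Y \<Longrightarrow> \<pi> (bscale Y c y) = bscale X c (\<pi> y)"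
  "\<pi> (bzero Y) = bzero X"
  using \<pi> continuous_linear_zero[OF proper(3,1) \<pi>] by (simp_all add: continuous_linear_def)

lemma j_linear:
  "x \<in> bcarrier X \<Longrightarrow> y \<in> bcarrier X \<Longrightarrow> j (badd X x y) = badd Y (j x) (j y)"
  "x \<in> bcarrier X \<Longrightarrow> j (bscale X c x) = bscale Y c (j x)"
  using j by (simp_all add: continuous_linear_def)

lemma j_bzero: "j (bzero X) = bzero Y"
  using continuous_linear_zero[OF proper(1,3) j] by simp

lemmas \<sigma>_linear = functional_simps[OF proper(2) \<sigma>]

lemma eqI:
  assumes "y \<in> bcarrier Y" "z \<in> bcarrier Y" "\<pi> y = \<pi> z" "\<sigma> y = \<sigma> z"
  shows "y = z"
  using decomposition[OF assms(1)] decomposition[OF assms(2)] assms(3,4) by metis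

text \<open>By linearity \<open>f\<close> is determined by its pullback along \<open>j\<close> and
  its value at \<open>u\<close>; these two become the coordinates of the dual.\<close>

lemma functional_decomposition:
  assumes f: "f \<in> continuous_functionals Y" and y: "y \<in> bcarrier Y"
  shows "f y = f (j (\<pi> y)) + \<sigma> y * f u"
  using functional_simps[OF proper(2) f] decomposition[OF y] y u
  by (metis Y.bscale_closed \<pi>_closed j_closed)

text \<open>Transposition exchanges the roles: \<open>\<pi>\<close> gives the embedding,
  \<open>j\<close> the projection, \<open>u\<close> the scalar coordinate and
  \<open>\<sigma>\<close> the new distinguished vector. Left and right actions also trade places,
  which is harmless because their formulas have the same shape.\<close>

lemma unitization_bimodule_strong_dual:
  "unitization_bimodule (strong_dual X) (strong_dual Y) (pullback Y \<pi>) (pullback X j)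
     (evaluation Y u) \<sigma> \<epsilon> (\<lambda>b. evaluation X (\<iota> b))"
proof (intro unitization_bimodule.intro tame_strong_dual unitization_bimodule_axioms.intro)
  show "tame_bimodule X" "tame_bimodule Y" by unfold_locales
  show "continuous_linear (strong_dual X) (restriction (strong_dual Y)) (pullback Y \<pi>)"
    using continuous_linear_pullback[OF proper(3,1) \<pi>] by (simp add: restriction_strong_dual)
  show "continuous_linear (restriction (strong_dual Y)) (strong_dual X) (pullback X j)"
    using continuous_linear_pullback[OF proper(1,3) j] by (simp add: restriction_strong_dual)
  show "evaluation Y u \<in> continuous_functionals (strong_dual Y)"
    by (rule evaluation_closed[OF proper(2) Y.bounded_point[OF u]])
  show "\<sigma> \<in> bcarrier (strong_dual Y)" using \<sigma> by simp
  show "\<epsilon> b \<in> bcarrier (strong_dual X)" for b using \<epsilon> by simp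
  show "evaluation X (\<iota> b) \<in> continuous_functionals (strong_dual X)" for b
    by (rule evaluation_closed[OF proper(1) X.bounded_point[OF \<iota>]])
  have cl_\<pi>: "pullback Y \<pi> f \<in> continuous_functionals Y" if "f \<in> continuous_functionals X" for f
    using pullback_closed[OF proper(3,1) \<pi> that] by simp
  have cl_j: "pullback X j f \<in> continuous_functionals X" if "f \<in> continuous_functionals Y" for f
    using pullback_closed[OF proper(1,3) j] that by simp
  have out: "f y = 0" if "f \<in> continuous_functionals Z" "y \<notin> bcarrier Z" for f y and Z :: "('c, 'z) bimodule"
    using that by (simp add: continuous_functionals_def)
  show "pullback X j (pullback Y \<pi> f) = f" if "f \<in> bcarrier (strong_dual X)" for f
    using that by (auto simp: pullback_def fun_eq_iff j_closed \<pi>_j out)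
  show "evaluation Y u (pullback Y \<pi> f) = 0" if "f \<in> bcarrier (strong_dual X)" for f
    using that functional_simps[OF proper(1), of f]
    by (simp add: evaluation_def cl_\<pi>) (simp add: pullback_def \<pi>_u)
  show "pullback X j \<sigma> = bzero (strong_dual X)"
    by (auto simp: pullback_def \<sigma>_j)
  show "evaluation Y u \<sigma> = 1" using \<sigma> by (simp add: evaluation_def \<sigma>_u)
  fix f assume "f \<in> bcarrier (strong_dual Y)"
  then have f: "f \<in> continuous_functionals Y" by simp
  note f_simps = functional_simps[OF proper(2) f]
  show "badd (strong_dual Y) (pullback Y \<pi> (pullback X j f)) (bscale (strong_dual Y) (evaluation Y u f) \<sigma>) = f"
    using functional_decomposition[OF f] f out[OF f] out[OF \<sigma>]
    by (auto simp: pullback_def fun_eq_iff evaluation_def \<pi>_closed)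
  fix b \<beta>
  \<comment> \<open>Together with \<open>cl_j\<close>, this makes \<open>evaluation\<close> return
    the true value and not its default 0.\<close>
  have act: "lact (strong_dual Y) c f \<in> continuous_functionals Y"
    "ract (strong_dual Y) f c \<in> continuous_functionals Y" for c
    using proper_bimodule.lact_closed[OF proper_strong_dual[OF proper(2)]]
      proper_bimodule.ract_closed[OF proper_strong_dual[OF proper(2)]] f by auto
  note cl = X.badd_closed X.bscale_closed X.lact_closed X.ract_closed Y.badd_closed Y.bscale_closed
    Y.lact_closed Y.ract_closed j_closed \<pi>_closed \<iota> u X.bzero_closed
  have fj: "x \<in> bcarrier X \<Longrightarrow> y \<in> bcarrier X \<Longrightarrow> f (j (badd X x y)) = f (j x) + f (j y)"
    "x \<in> bcarrier X \<Longrightarrow> f (j (bscale X c x)) = c * f (j x)" "f (j (bzero X)) = 0" for x y c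
    by (simp_all add: j_linear f_simps cl j_bzero)
  \<comment> \<open>On \<open>j x\<close> the scalar coordinate is 0, so \<open>\<iota>\<close>
    drops out; the new scalar coordinate \<open>\<epsilon> b x\<close> is multiplied by
    \<open>f u\<close>. Hence \<open>\<epsilon>\<close> plays the part of \<open>\<iota>\<close> in
    the dual.\<close>
  have R: "f (ract Y (j x) (Unitization b \<beta>)) = f (j (ract X x b)) + \<beta> * f (j x) + f u * \<epsilon> b x"
    "f (lact Y (Unitization b \<beta>) (j x)) = f (j (lact X b x)) + \<beta> * f (j x) + f u * \<epsilon> b x"
    if "x \<in> bcarrier X" for x
    using that functional_decomposition[OF f, of "ract Y (j x) (Unitization b \<beta>)"]
      functional_decomposition[OF f, of "lact Y (Unitization b \<beta>) (j x)"]
    by (simp_all add: cl \<pi>_ract \<sigma>_ract \<pi>_lact \<sigma>_lact \<pi>_j \<sigma>_j fj X.bscale_0)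
  show "pullback X j (lact (strong_dual Y) (Unitization b \<beta>) f) =
    badd (strong_dual X)
      (badd (strong_dual X) (lact (strong_dual X) b (pullback X j f))
        (bscale (strong_dual X) \<beta> (pullback X j f)))
      (bscale (strong_dual X) (evaluation Y u f) (\<epsilon> b))"
    using f R out[OF \<epsilon>[of b]] by (auto simp: pullback_def fun_eq_iff evaluation_def cl)
  show "pullback X j (ract (strong_dual Y) f (Unitization b \<beta>)) =
    badd (strong_dual X)
      (badd (strong_dual X) (ract (strong_dual X) (pullback X j f) b)
        (bscale (strong_dual X) \<beta> (pullback X j f)))
      (bscale (strong_dual X) (evaluation Y u f) (\<epsilon> b))"
    using f R out[OF \<epsilon>[of b]] by (auto simp: pullback_def fun_eq_iff evaluation_def cl)
  have act_bzero: "lact X b (bzero X) = bzero X" "ract X (bzero X) b = bzero X"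
    using continuous_linear_zero[OF proper(1,1) continuous_linear_act(1)[OF proper(1)]]
      continuous_linear_zero[OF proper(1,1) continuous_linear_act(2)[OF proper(1)]] .
  \<comment> \<open>On \<open>u\<close> the coordinate in \<open>X\<close> is zero, so only
    \<open>\<iota> b\<close> and the multiple of \<open>u\<close> survive. This turns evaluation at
    \<open>\<iota> b\<close> into the new \<open>\<epsilon>\<close>.\<close>
  have U: "f (ract Y u (Unitization b \<beta>)) = f (j (\<iota> b)) + \<beta> * f u"
    "f (lact Y (Unitization b \<beta>) u) = f (j (\<iota> b)) + \<beta> * f u"
    using functional_decomposition[OF f, of "ract Y u (Unitization b \<beta>)"]
      functional_decomposition[OF f, of "lact Y (Unitization b \<beta>) u"]
      functional_simps[OF proper(1) \<epsilon>[of b]]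
    by (simp_all add: cl \<pi>_ract \<sigma>_ract \<pi>_lact \<sigma>_lact \<pi>_u \<sigma>_u fj act_bzero
        X.bscale_bzero)
  show "evaluation Y u (lact (strong_dual Y) (Unitization b \<beta>) f) =
      evaluation X (\<iota> b) (pullback X j f) + \<beta> * evaluation Y u f"
    using act(1)[of "Unitization b \<beta>"] cl_j[OF f] f U
    by (simp add: evaluation_def) (simp add: pullback_def cl)
  show "evaluation Y u (ract (strong_dual Y) f (Unitization b \<beta>)) =
      evaluation X (\<iota> b) (pullback X j f) + \<beta> * evaluation Y u f"
    using act(2)[of "Unitization b \<beta>"] cl_j[OF f] f U
    by (simp add: evaluation_def) (simp add: pullback_def cl)
qed

text \<open>Iterated duals are given only up to isomorphism, so the splitting has to be carried
  over. \<open>\<sigma>\<close> and the \<open>\<epsilon> b\<close> go through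
  \<open>pullback\<close> and not through plain composition, to be 0 off the new carriers.\<close>

lemma unitization_bimodule_isomorphic:
  fixes X' :: "('a, 'x2) bimodule" and Y' :: "('a unitization, 'y2) bimodule"
  assumes \<phi>: "bimodule_isomorphism X X' \<phi>" and \<psi>: "bimodule_isomorphism Y Y' \<psi>"
  defines "\<phi>' \<equiv> inv_into (bcarrier X) \<phi>" and "\<psi>' \<equiv> inv_into (bcarrier Y) \<psi>"
  shows "unitization_bimodule X' Y' (\<psi> \<circ> j \<circ> \<phi>') (\<phi> \<circ> \<pi> \<circ> \<psi>') (pullback Y' \<psi>' \<sigma>) (\<psi> u) (\<phi> \<circ> \<iota>)
    (\<lambda>b. pullback X' \<phi>' (\<epsilon> b))"
proof -
  have \<phi>i: "bimodule_isomorphism X' X \<phi>'" and \<psi>i: "bimodule_isomorphism Y' Y \<psi>'"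
    unfolding \<phi>'_def \<psi>'_def using \<phi> \<psi> proper by (blast intro: bimodule_isomorphism_sym)+
  have bij: "bij_betw \<phi> (bcarrier X) (bcarrier X')" "bij_betw \<psi> (bcarrier Y) (bcarrier Y')"
    using \<phi> \<psi> by (simp_all add: bimodule_isomorphism_def)
  have inv: "x \<in> bcarrier X \<Longrightarrow> \<phi>' (\<phi> x) = x" "y \<in> bcarrier Y \<Longrightarrow> \<psi>' (\<psi> y) = y"
    "x' \<in> bcarrier X' \<Longrightarrow> \<phi> (\<phi>' x') = x'" "y' \<in> bcarrier Y' \<Longrightarrow> \<psi> (\<psi>' y') = y'" for x y x' y'
    using bij_betw_inv_into_left[OF bij(1)] bij_betw_inv_into_left[OF bij(2)]
      bij_betw_inv_into_right[OF bij(1)] bij_betw_inv_into_right[OF bij(2)]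
    by (simp_all add: \<phi>'_def \<psi>'_def)
  have tame: "tame_bimodule X'" "tame_bimodule Y'"
    using tame_isomorphic[OF X.tame_bimodule_axioms] tame_isomorphic[OF Y.tame_bimodule_axioms] \<phi> \<psi>
    by (auto simp: bimodule_isomorphic_def)
  then have proper': "proper_bimodule X'" "proper_bimodule Y'" "proper_bimodule (restriction Y')"
    by (simp_all add: tame_bimodule_def proper_restriction)
  note lin = bimodule_isomorphism_linear[OF \<phi>] bimodule_isomorphism_linear[OF \<phi>i]
    bimodule_isomorphism_linear[OF bimodule_isomorphism_restriction[OF \<psi>]]
    bimodule_isomorphism_linear[OF bimodule_isomorphism_restriction[OF \<psi>i]]
  note cl = X.badd_closed X.bscale_closed X.lact_closed X.ract_closed Y.badd_closed Y.bscale_closed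
    Y.lact_closed Y.ract_closed j_closed \<pi>_closed \<iota> u
    bimodule_isomorphism_image[OF \<phi>] bimodule_isomorphism_image[OF \<phi>i]
    bimodule_isomorphism_image[OF \<psi>] bimodule_isomorphism_image[OF \<psi>i]
    proper_bimodule.lact_closed[OF proper'(2)] proper_bimodule.ract_closed[OF proper'(2)]
  note hom = \<phi>[unfolded bimodule_isomorphism_def] \<psi>[unfolded bimodule_isomorphism_def]
    \<phi>i[unfolded bimodule_isomorphism_def] \<psi>i[unfolded bimodule_isomorphism_def]
  show ?thesis
  proof (intro unitization_bimodule.intro tame unitization_bimodule_axioms.intro)
    show "continuous_linear X' (restriction Y') (\<psi> \<circ> j \<circ> \<phi>')"
      by (rule continuous_linear_compose[OF proper'(1) proper(1) lin(2)
            continuous_linear_compose[OF proper(1,3) j lin(3)]])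
    show "continuous_linear (restriction Y') X' (\<phi> \<circ> \<pi> \<circ> \<psi>')"
      by (rule continuous_linear_compose[OF proper'(3) proper(3) lin(4)
            continuous_linear_compose[OF proper(3,1) \<pi> lin(1)]])
    show "pullback Y' \<psi>' \<sigma> \<in> continuous_functionals Y'"
      by (rule pullback_closed[OF proper'(2) proper(2) bimodule_isomorphism_linear[OF \<psi>i] \<sigma>])
    show "pullback X' \<phi>' (\<epsilon> b) \<in> continuous_functionals X'" for b
      by (rule pullback_closed[OF proper'(1) proper(1) lin(2) \<epsilon>])
    show "(\<phi> \<circ> \<pi> \<circ> \<psi>') (\<psi> u) = bzero X'" using hom by (simp add: inv cl \<pi>_u)
    show "badd Y' ((\<psi> \<circ> j \<circ> \<phi>') ((\<phi> \<circ> \<pi> \<circ> \<psi>') y)) (bscale Y' (pullback Y' \<psi>' \<sigma> y) (\<psi> u)) = y"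
      if y: "y \<in> bcarrier Y'" for y
    proof -
      have "\<psi> (badd Y (j (\<pi> (\<psi>' y))) (bscale Y (\<sigma> (\<psi>' y)) u)) = y"
        using decomposition[of "\<psi>' y"] y by (simp add: cl inv)
      then show ?thesis using hom y by (simp add: pullback_def inv cl)
    qed
  qed (use hom in \<open>simp_all add: pullback_def inv cl \<pi>_j \<sigma>_j \<sigma>_u \<pi>_lact \<pi>_ract \<sigma>_lact \<sigma>_ract\<close>)
qed

end

section \<open>Splitting of all iterated duals of the unitization\<close>

text \<open>In the product of the unitization the correction term \<open>\<iota>\<close> is the
  identity and \<open>\<epsilon>\<close> is zero. The three coordinate maps are continuous because
  each seminorm of the unitization is the sum of \<open>p l\<close> and the modulus of the scalar
  part.\<close>

lemma unitization_bimodule_regular: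
  fixes p :: "nat \<Rightarrow> 'a::complex_algebra \<Rightarrow> real"
  assumes p: "\<And>l. submultiplicative_seminorm (p l)"
  shows "unitization_bimodule (regular_bimodule p) (regular_bimodule (unitization_seminorms p))
    (\<lambda>a. Unitization a 0) algebra_part scalar_part (Unitization 0 1) (\<lambda>b. b) (\<lambda>b x. 0)"
proof (intro unitization_bimodule.intro unitization_bimodule_axioms.intro)
  let ?q = "unitization_seminorms p"
  have q: "submultiplicative_seminorm (?q l)" for l
    by (intro submultiplicative_unitization_seminorms p)
  note p_simps = submultiplicative_seminormD[OF p]
  show "tame_bimodule (regular_bimodule p)" "tame_bimodule (regular_bimodule ?q)"
    by (rule tame_regular_bimodule, rule p q)+
  note ops = plus_unitization_def times_unitization_def scaleC_unitization_def minus_unitization_def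
  have "continuous_map (algebra_topology p) (algebra_topology ?q) (\<lambda>a. Unitization a 0)"
    unfolding algebra_topology_def[of ?q]
  proof (rule continuous_map_into_seminorm_topology)
    show "(\<lambda>a. Unitization a 0) ` topspace (algebra_topology p) \<subseteq> topspace (seminorm_topology UNIV (range ?q))"
      using topspace_algebra_topology[of ?q, OF q] by (simp add: algebra_topology_def)
    fix r and x :: "'a unitization" assume "r \<in> range ?q"
    then obtain l where r: "r = ?q l" by blast
    show "continuous_map (algebra_topology p) euclideanreal (\<lambda>a. r (Unitization a 0 - x))"
      unfolding algebra_topology_def
    proof (rule continuous_map_from_seminorm_topology[of "p l"])
      show "dist (r (Unitization a 0 - x)) (r (Unitization b 0 - x)) \<le> p l (a - b)" for a b
        using p_simps(5)[of l "a - algebra_part x" "b - algebra_part x"]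
        by (simp add: r unitization_seminorms_def ops dist_norm)
    qed (simp_all add: p_simps)
  qed simp
  then show "continuous_linear (regular_bimodule p) (restriction (regular_bimodule ?q)) (\<lambda>a. Unitization a 0)"
    by (simp add: continuous_linear_def regular_bimodule_def ops)
  note q_0 = submultiplicative_seminormD(4)[OF q]
  have "continuous_map (algebra_topology ?q) (algebra_topology p) algebra_part"
    unfolding algebra_topology_def[of p]
  proof (rule continuous_map_into_seminorm_topology)
    show "algebra_part ` topspace (algebra_topology ?q) \<subseteq> topspace (seminorm_topology UNIV (range p))"
      using topspace_algebra_topology[of p, OF p] by (simp add: algebra_topology_def)
    fix r and x :: 'a assume "r \<in> range p"
    then obtain l where r: "r = p l" by blast
    show "continuous_map (algebra_topology ?q) euclideanreal (\<lambda>z. r (algebra_part z - x))"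
      unfolding algebra_topology_def
    proof (rule continuous_map_from_seminorm_topology[of "?q l"])
      show "dist (r (algebra_part a - x)) (r (algebra_part b - x)) \<le> ?q l (a - b)" for a b
        using p_simps(5)[of l "algebra_part a - x" "algebra_part b - x"]
        by (simp add: r unitization_seminorms_def ops dist_norm add_increasing2)
    qed (simp_all add: q_0)
  qed simp
  then show "continuous_linear (restriction (regular_bimodule ?q)) (regular_bimodule p) algebra_part"
    by (simp add: continuous_linear_def regular_bimodule_def ops)
  \<comment> \<open>Each \<open>?q l\<close> dominates the modulus of the scalar part; the index 0
    is an arbitrary choice.\<close>
  have "continuous_map (algebra_topology ?q) euclidean scalar_part"
    unfolding algebra_topology_def
    by (rule continuous_map_from_seminorm_topology[of "?q 0"])
      (simp_all add: q_0, simp add: unitization_seminorms_def ops dist_norm p_simps)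
  then show "scalar_part \<in> continuous_functionals (regular_bimodule ?q)"
    by (simp add: continuous_functionals_def regular_bimodule_def ops)
qed (simp_all add: regular_bimodule_def zero_continuous_functional zero_unitization_def
    plus_unitization_def times_unitization_def scaleC_unitization_def scaleC_zero_right)

text \<open>Induction on \<open>n\<close>: each step dualizes the splitting and transports it to the
  given realizations. Dualizing exchanges \<open>\<iota>\<close> and \<open>\<epsilon>\<close>, so
  the one that vanishes alternates with the parity of \<open>n\<close>.\<close>

lemma iterated_dual_unitization_bimodule:
  fixes p :: "nat \<Rightarrow> 'a::complex_algebra \<Rightarrow> real"
    and X :: "('a, 'u) bimodule" and Y :: "('a unitization, 'v) bimodule"
  assumes "iterated_dual p n X" "iterated_dual (unitization_seminorms p) n Y"
    and p: "\<And>l. submultiplicative_seminorm (p l)"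
  shows "\<exists>j \<pi> \<sigma> u \<iota> \<epsilon>. unitization_bimodule X Y j \<pi> \<sigma> u \<iota> \<epsilon> \<and>
    (if even n then \<forall>b x. \<epsilon> b x = 0 else \<forall>b. \<iota> b = bzero X)"
  using assms(1,2)
proof (induction n arbitrary: X Y)
  case 0
  from 0(1) obtain \<phi> where \<phi>: "bimodule_isomorphism (regular_bimodule p) X \<phi>"
    by cases (auto simp: bimodule_isomorphic_def)
  from 0(2) obtain \<psi> where \<psi>: "bimodule_isomorphism (regular_bimodule (unitization_seminorms p)) Y \<psi>"
    by cases (auto simp: bimodule_isomorphic_def)
  show ?case
    using unitization_bimodule.unitization_bimodule_isomorphic[OF unitization_bimodule_regular[OF p] \<phi> \<psi>]
    by (fastforce simp: pullback_def)
next
  case (Suc n)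
  from Suc.prems(1) obtain X0 :: "('a, 'u) bimodule" and \<phi> where X0: "iterated_dual p n X0"
    and \<phi>: "bimodule_isomorphism (strong_dual X0) X \<phi>"
    by cases (auto simp: bimodule_isomorphic_def)
  from Suc.prems(2) obtain Y0 :: "('a unitization, 'v) bimodule" and \<psi>
    where Y0: "iterated_dual (unitization_seminorms p) n Y0"
    and \<psi>: "bimodule_isomorphism (strong_dual Y0) Y \<psi>"
    by cases (auto simp: bimodule_isomorphic_def)
  obtain j \<pi> \<sigma> u \<iota> \<epsilon> where 1: "unitization_bimodule X0 Y0 j \<pi> \<sigma> u \<iota> \<epsilon>"
    and 2: "if even n then \<forall>b x. \<epsilon> b x = 0 else \<forall>b. \<iota> b = bzero X0"
    using Suc.IH[OF X0 Y0] by blast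
  interpret unitization_bimodule X0 Y0 j \<pi> \<sigma> u \<iota> \<epsilon> by (rule 1)
  have "if even (Suc n) then \<forall>b. evaluation X0 (\<iota> b) = (\<lambda>f. 0) else \<forall>b. \<epsilon> b = (\<lambda>x. 0)"
    using 2 functional_simps(3)[OF proper(1)] by (auto simp: evaluation_def fun_eq_iff split: if_splits)
  moreover have "\<phi> (\<lambda>x. 0) = bzero X" using \<phi> by (simp add: bimodule_isomorphism_def)
  ultimately have *: "if even (Suc n)
      then \<forall>b x. pullback X (inv_into (bcarrier (strong_dual X0)) \<phi>) (evaluation X0 (\<iota> b)) x = 0
      else \<forall>b. (\<phi> \<circ> \<epsilon>) b = bzero X"
    by (auto simp: pullback_def split: if_splits)
  show ?case
    \<comment> \<open>The witnesses are found by unification with the transported dual splitting;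
      \<open>*\<close> then supplies the parity claim for them.\<close>
    by (intro exI conjI, rule unitization_bimodule.unitization_bimodule_isomorphic[OF
          unitization_bimodule_strong_dual \<phi> \<psi>], rule *)
qed

section \<open>Derivations of the unitization\<close>

text \<open>For \<open>D a = f(a) f\<close>, all three terms of the product rule contain a value of
  \<open>f\<close> at a product and so vanish. Weak amenability enters the proof only here.\<close>

lemma weakly_amenable_functional_eq_0:
  assumes p: "\<And>l. submultiplicative_seminorm (p l)" and wa: "weakly_amenable p"
    and f: "f \<in> continuous_functionals (regular_bimodule p)" and products: "\<And>a b. f (a * b) = 0"
  shows "f a = 0"
proof -
  let ?A = "regular_bimodule p"
  have A: "proper_bimodule ?A" by (rule proper_regular_bimodule[OF p])
  have A_simps: "bcarrier ?A = UNIV" "badd ?A = (+)" "bscale ?A = scaleC" "btop ?A = algebra_topology p"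
    "lact ?A = (*)" "ract ?A = (*)"
    by (simp_all add: regular_bimodule_def)
  note f_simps = functional_simps[OF A f, unfolded A_simps]
  define D where "D a = (\<lambda>x. f a * f x)" for a
  have "continuous_map (algebra_topology p) euclidean f"
    using f by (simp add: continuous_functionals_def A_simps)
  from continuous_map_compose[OF this continuous_map_bscale_strong_dual[OF A f]]
  have "continuous_map (algebra_topology p) (btop (strong_dual ?A)) D"
    by (simp add: D_def[abs_def] o_def)
  moreover have "D a \<in> continuous_functionals ?A" for a
    using proper_bimodule.bscale_closed[OF proper_strong_dual[OF A], of f "f a"] f by (simp add: D_def)
  ultimately have "continuous_derivation p (strong_dual ?A) D"
    by (auto simp: continuous_derivation_def D_def pullback_def A_simps f_simps products algebra_simps)
  then obtain g where g: "D b = (\<lambda>x. g (x * b) + (-1) * g (b * x))" for b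
    using wa unfolding weakly_amenable_def inner_derivation_def
    by (fastforce simp: pullback_def A_simps)
  have "f a * f a = D a a" by (simp add: D_def)
  also have "\<dots> = 0" by (simp add: g)
  finally show ?thesis by simp
qed

lemma unitization_decomposition:
  "Unitization b \<beta> = Unitization b 0 + \<beta> *\<^sub>C Unitization 0 (1::complex)"
  by (simp add: plus_unitization_def scaleC_unitization_def scaleC_zero_right)

text \<open>Realizing the modules as strong duals makes their vector space operations pointwise.\<close>

locale even_unitization_bimodule =
  unitization_bimodule "strong_dual V" "strong_dual W" j \<pi> \<sigma> u \<iota> \<epsilon>
  for V :: "('a::complex_algebra, 'x) bimodule" and W :: "('a unitization, 'y) bimodule"
    and j \<pi> \<sigma> u \<iota> \<epsilon> +
  fixes p :: "nat \<Rightarrow> 'a \<Rightarrow> real"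
  assumes p: "\<And>l. submultiplicative_seminorm (p l)"
    and \<epsilon>_eq_0: "\<epsilon> b x = 0"
begin

abbreviation "M \<equiv> strong_dual V"
abbreviation "N \<equiv> strong_dual W"

lemma continuous_algebra_embedding:
    "continuous_map (algebra_topology p) (algebra_topology (unitization_seminorms p)) (\<lambda>a. Unitization a 0)"
  and continuous_algebra_part:
    "continuous_map (algebra_topology (unitization_seminorms p)) (algebra_topology p) algebra_part"
proof -
  \<comment> \<open>The two maps are the embedding and the projection in the splitting of the
    unitization as a bimodule over itself.\<close>
  interpret R: unitization_bimodule "regular_bimodule p" "regular_bimodule (unitization_seminorms p)"
    "\<lambda>a. Unitization a 0" algebra_part scalar_part "Unitization 0 1" "\<lambda>b. b" "\<lambda>b x. 0"
    by (rule unitization_bimodule_regular[OF p])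
  show "continuous_map (algebra_topology p) (algebra_topology (unitization_seminorms p)) (\<lambda>a. Unitization a 0)"
    "continuous_map (algebra_topology (unitization_seminorms p)) (algebra_topology p) algebra_part"
    using R.j R.\<pi> by (simp_all add: continuous_linear_def regular_bimodule_def)
qed

text \<open>The extension kills the identity. The terms \<open>\<beta> D(a)\<close> and
  \<open>\<alpha> D(b)\<close> that arise from \<open>D\<close> on the product reappear in the two
  actions; the \<open>\<iota>\<close> terms vanish because the image of \<open>j\<close> has scalar
  coordinate 0, and the scalar coordinates match because \<open>\<epsilon>\<close> is zero.\<close>

lemma extended_derivation:
  assumes D: "continuous_derivation p M D"
  shows "continuous_derivation (unitization_seminorms p) N (\<lambda>z. j (D (algebra_part z)))"
  unfolding continuous_derivation_def
proof (intro conjI allI)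
  have D_cl: "D a \<in> bcarrier M"
    and D_lin: "D (a + b) = badd M (D a) (D b)" "D (c *\<^sub>C a) = bscale M c (D a)"
    and D_mult: "D (a * b) = badd M (lact M a (D b)) (ract M (D a) b)" for a b c
    using D unfolding continuous_derivation_def by blast+
  note cl = X.badd_closed X.bscale_closed X.lact_closed X.ract_closed Y.badd_closed Y.bscale_closed
    Y.lact_closed Y.ract_closed j_closed D_cl
  have "continuous_map (btop M) (btop N) j" using j by (simp add: continuous_linear_def)
  moreover have "continuous_map (algebra_topology p) (btop M) D"
    using D by (simp add: continuous_derivation_def)
  ultimately have "continuous_map (algebra_topology (unitization_seminorms p)) (btop N) (j \<circ> (D \<circ> algebra_part))"
    by (meson continuous_map_compose continuous_algebra_part)
  then show "continuous_map (algebra_topology (unitization_seminorms p)) (btop N)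
      (\<lambda>z. j (D (algebra_part z)))"
    by (simp add: o_def)
  fix y z c
  show "j (D (algebra_part z)) \<in> bcarrier N" by (intro cl)
  show "j (D (algebra_part (y + z))) = badd N (j (D (algebra_part y))) (j (D (algebra_part z)))"
    unfolding plus_unitization_def unitization.sel D_lin by (intro j_linear D_cl)
  show "j (D (algebra_part (c *\<^sub>C z))) = bscale N c (j (D (algebra_part z)))"
    unfolding scaleC_unitization_def unitization.sel D_lin by (intro j_linear D_cl)
  obtain a \<alpha> b \<beta> where yz: "y = Unitization a \<alpha>" "z = Unitization b \<beta>"
    by (cases y, cases z) blast
  show "j (D (algebra_part (y * z))) =
      badd N (lact N y (j (D (algebra_part z)))) (ract N (j (D (algebra_part y))) z)"
    unfolding yz unitization.sel
  proof (rule eqI)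
    have "\<pi> (badd N (lact N (Unitization a \<alpha>) (j (D b))) (ract N (j (D a)) (Unitization b \<beta>))) =
      badd M
        (badd M (badd M (lact M a (D b)) (bscale M \<alpha> (D b))) (bscale M 0 (\<iota> a)))
        (badd M (badd M (ract M (D a) b) (bscale M \<beta> (D a))) (bscale M 0 (\<iota> b)))"
      by (simp only: \<pi>_linear \<pi>_lact \<pi>_ract cl \<pi>_j \<sigma>_j)
    then show "\<pi> (j (D (algebra_part (Unitization a \<alpha> * Unitization b \<beta>)))) =
      \<pi> (badd N (lact N (Unitization a \<alpha>) (j (D b))) (ract N (j (D a)) (Unitization b \<beta>)))"
      by (simp only: times_unitization_def unitization.sel \<pi>_j cl D_lin D_mult)
        (simp add: algebra_simps)
    show "\<sigma> (j (D (algebra_part (Unitization a \<alpha> * Unitization b \<beta>)))) =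
      \<sigma> (badd N (lact N (Unitization a \<alpha>) (j (D b))) (ract N (j (D a)) (Unitization b \<beta>)))"
      by (simp only: \<sigma>_linear \<sigma>_lact \<sigma>_ract cl \<sigma>_j \<epsilon>_eq_0) simp
  qed (intro cl)+
qed

text \<open>If \<open>y\<close> implements the extended derivation, then \<open>\<pi> y\<close>
  implements \<open>D\<close>: apply \<open>\<pi>\<close> at \<open>(b, 0)\<close>.\<close>

lemma inner_if_inner_unitization:
  assumes inner: "\<And>D. continuous_derivation (unitization_seminorms p) N D \<Longrightarrow> inner_derivation N D"
    and D: "continuous_derivation p M D"
  shows "inner_derivation M D"
proof -
  obtain y where y: "y \<in> bcarrier N"
    and eq: "j (D (algebra_part z)) = badd N (lact N z y) (bscale N (-1) (ract N y z))" for z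
    using inner[OF extended_derivation[OF D]] unfolding inner_derivation_def by blast
  note cl = X.badd_closed X.bscale_closed X.lact_closed X.ract_closed Y.badd_closed Y.bscale_closed
    Y.lact_closed Y.ract_closed j_closed \<pi>_closed y
  have "D b = badd M (lact M b (\<pi> y)) (bscale M (-1) (ract M (\<pi> y) b))" for b
  proof -
    have "D b \<in> bcarrier M" using D by (simp only: continuous_derivation_def)
    then have "D b = \<pi> (badd N (lact N (Unitization b 0) y) (bscale N (-1) (ract N y (Unitization b 0))))"
      using eq[of "Unitization b 0"] by (metis \<pi>_j unitization.sel(1))
    \<comment> \<open>The term \<open>\<sigma> y\<close> times \<open>\<iota> b\<close> occurs in
      both actions and cancels in the commutator.\<close>
    also have "\<dots> = badd M
        (badd M (badd M (lact M b (\<pi> y)) (bscale M 0 (\<pi> y))) (bscale M (\<sigma> y) (\<iota> b)))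
        (bscale M (-1) (badd M (badd M (ract M (\<pi> y) b) (bscale M 0 (\<pi> y))) (bscale M (\<sigma> y) (\<iota> b))))"
      by (simp only: \<pi>_linear \<pi>_lact \<pi>_ract cl)
    finally show ?thesis by simp
  qed
  then show ?thesis unfolding inner_derivation_def using \<pi>_closed[OF y] by blast
qed

section \<open>Derivations of the unitization into an even dual\<close>

context
  fixes D
  assumes D: "continuous_derivation (unitization_seminorms p) N D"
begin

lemma derivation_simps:
  "D z \<in> bcarrier N" "D (y + z) = badd N (D y) (D z)" "D (c *\<^sub>C z) = bscale N c (D z)"
  "D (y * z) = badd N (lact N y (D z)) (ract N (D y) z)"
  using D unfolding continuous_derivation_def by blast+

text \<open>The identity acts trivially in both coordinates, so \<open>e e = e\<close> makes each
  coordinate of \<open>D e\<close> equal to its double.\<close>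

lemma derivation_identity: "\<pi> (D (Unitization 0 1)) = bzero M" "\<sigma> (D (Unitization 0 1)) = 0"
proof -
  let ?e = "Unitization 0 1 :: 'a unitization"
  note cl = derivation_simps(1) Y.lact_closed Y.ract_closed
  have "D (?e * ?e) = D ?e"
    by (simp add: times_unitization_def scaleC_zero_right)
  then have e: "D ?e = badd N (lact N ?e (D ?e)) (ract N (D ?e) ?e)"
    unfolding derivation_simps(4) by (rule sym)
  have "\<sigma> (D ?e) = \<sigma> (D ?e) + \<sigma> (D ?e)"
    by (subst e) (simp only: \<sigma>_linear \<sigma>_lact \<sigma>_ract cl \<epsilon>_eq_0, simp)
  then show s: "\<sigma> (D ?e) = 0" by simp
  \<comment> \<open>The scalar coordinate has to be treated first: its vanishing gives
    \<open>\<iota> 0\<close> the coefficient 0. The actions of the algebra part of the identity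
    vanish by \<open>X.lact_0\<close> and \<open>X.ract_0\<close>.\<close>
  have "\<pi> (D ?e) = badd M
      (badd M (badd M (bzero M) (bscale M 1 (\<pi> (D ?e)))) (bscale M 0 (\<iota> 0)))
      (badd M (badd M (bzero M) (bscale M 1 (\<pi> (D ?e)))) (bscale M 0 (\<iota> 0)))"
    by (subst e) (simp only: \<pi>_linear \<pi>_lact \<pi>_ract cl s \<pi>_closed X.lact_0 X.ract_0)
  then show "\<pi> (D ?e) = bzero M" by (simp add: fun_eq_iff)
qed

text \<open>Applying \<open>\<pi>\<close> to the product rule leaves the terms
  \<open>\<sigma> (D (b, 0)) \<iota>(a)\<close> and \<open>\<sigma> (D (a, 0)) \<iota>(b)\<close>;
  the premise removes them.\<close>

lemma restricted_derivation: "continuous_derivation p M (\<lambda>a. \<pi> (D (Unitization a 0)))"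
  if "\<And>a. \<sigma> (D (Unitization a 0)) = 0"
  unfolding continuous_derivation_def
proof (intro conjI allI)
  note cl = derivation_simps(1) Y.lact_closed Y.ract_closed \<pi>_closed
  have "continuous_map (btop N) (btop M) \<pi>" using \<pi> by (simp add: continuous_linear_def)
  moreover have "continuous_map (algebra_topology (unitization_seminorms p)) (btop N) D"
    using D by (simp add: continuous_derivation_def)
  ultimately have "continuous_map (algebra_topology p) (btop M) (\<pi> \<circ> (D \<circ> (\<lambda>a. Unitization a 0)))"
    by (intro continuous_map_compose[OF continuous_map_compose[OF continuous_algebra_embedding]])
  then show "continuous_map (algebra_topology p) (btop M) (\<lambda>a. \<pi> (D (Unitization a 0)))"
    by (simp add: o_def)
  fix a b c
  show "\<pi> (D (Unitization a 0)) \<in> bcarrier M" by (intro cl)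
  have "Unitization (a + b) 0 = Unitization a 0 + Unitization b 0"
    and "Unitization (c *\<^sub>C a) 0 = c *\<^sub>C Unitization a 0"
    and *: "Unitization (a * b) 0 = Unitization a 0 * Unitization b 0"
    by (simp_all add: plus_unitization_def scaleC_unitization_def times_unitization_def scaleC_zero_left)
  then show "\<pi> (D (Unitization (a + b) 0)) = badd M (\<pi> (D (Unitization a 0))) (\<pi> (D (Unitization b 0)))"
    "\<pi> (D (Unitization (c *\<^sub>C a) 0)) = bscale M c (\<pi> (D (Unitization a 0)))"
    by (simp_all only: derivation_simps \<pi>_linear)
  have "\<pi> (D (Unitization (a * b) 0)) = badd M
      (badd M (badd M (lact M a (\<pi> (D (Unitization b 0)))) (bscale M 0 (\<pi> (D (Unitization b 0)))))
        (bscale M 0 (\<iota> a)))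
      (badd M (badd M (ract M (\<pi> (D (Unitization a 0))) b) (bscale M 0 (\<pi> (D (Unitization a 0)))))
        (bscale M 0 (\<iota> b)))"
    unfolding * derivation_simps(4) by (simp only: \<pi>_linear \<pi>_lact \<pi>_ract cl that)
  then show "\<pi> (D (Unitization (a * b) 0)) =
      badd M (lact M a (\<pi> (D (Unitization b 0)))) (ract M (\<pi> (D (Unitization a 0))) b)"
    by simp
qed

text \<open>As \<open>\<epsilon>\<close> is zero, elements \<open>(a, 0)\<close> send everything to
  scalar coordinate 0. So the product rule makes this functional vanish on products.\<close>

lemma scalar_part_derivation_eq_0:
  assumes wa: "weakly_amenable p"
  shows "\<sigma> (D (Unitization a 0)) = 0"
proof -
  let ?f = "\<lambda>a. \<sigma> (D (Unitization a 0))"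
  note cl = derivation_simps(1) Y.lact_closed Y.ract_closed \<pi>_closed
  have "Unitization (a + b) 0 = Unitization a 0 + Unitization b 0"
    and "Unitization (c *\<^sub>C a) 0 = c *\<^sub>C Unitization a 0"
    and *: "Unitization (a * b) 0 = Unitization a 0 * Unitization b 0" for a b :: 'a and c
    by (simp_all add: plus_unitization_def scaleC_unitization_def times_unitization_def scaleC_zero_left)
  then have "?f (a + b) = ?f a + ?f b" "?f (c *\<^sub>C a) = c * ?f a" for a b c
    by (simp_all only: derivation_simps \<sigma>_linear)
  moreover have "continuous_map (btop N) euclidean \<sigma>" using \<sigma> by (simp add: continuous_functionals_def)
  with D have "continuous_map (algebra_topology p) euclidean (\<sigma> \<circ> (D \<circ> (\<lambda>a. Unitization a 0)))"
    unfolding continuous_derivation_def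
    by (intro continuous_map_compose[OF continuous_map_compose[OF continuous_algebra_embedding]]) blast+
  ultimately have "?f \<in> continuous_functionals (regular_bimodule p)"
    by (simp add: continuous_functionals_def regular_bimodule_def o_def)
  moreover have "?f (a * b) = 0" for a b
    unfolding * derivation_simps(4) by (simp only: \<sigma>_linear \<sigma>_lact \<sigma>_ract cl \<epsilon>_eq_0) simp
  ultimately show ?thesis by (rule weakly_amenable_functional_eq_0[OF p wa])
qed

text \<open>If \<open>x\<close> implements the restricted derivation, then \<open>j x\<close>
  implements \<open>D\<close>; both coordinates are compared separately.\<close>

lemma inner_unitization_if_inner:
  assumes wa: "weakly_amenable p"
    and inner: "\<And>D. continuous_derivation p M D \<Longrightarrow> inner_derivation M D"
  shows "inner_derivation N D"
proof -
  note s = scalar_part_derivation_eq_0[OF wa]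
  obtain x where x: "x \<in> bcarrier M"
    and eq: "\<pi> (D (Unitization b 0)) = badd M (lact M b x) (bscale M (-1) (ract M x b))" for b
    using inner[OF restricted_derivation[OF s]] unfolding inner_derivation_def by blast
  note cl = derivation_simps(1) X.badd_closed X.bscale_closed X.lact_closed X.ract_closed Y.badd_closed
    Y.bscale_closed Y.lact_closed Y.ract_closed j_closed \<pi>_closed x
  have "D z = badd N (lact N z (j x)) (bscale N (-1) (ract N (j x) z))" for z
  proof (rule eqI)
    obtain b \<beta> where z: "z = Unitization b \<beta>" by (cases z)
    \<comment> \<open>The second summand is zero, because \<open>D\<close> kills the
      identity.\<close>
    have Dz: "D z = badd N (D (Unitization b 0)) (bscale N \<beta> (D (Unitization 0 1)))"
      unfolding z by (subst unitization_decomposition) (simp only: derivation_simps)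
    have "\<pi> (D z) = badd M (\<pi> (D (Unitization b 0))) (bscale M \<beta> (bzero M))"
      unfolding Dz by (simp only: \<pi>_linear cl derivation_identity)
    \<comment> \<open>Here \<open>\<beta> x\<close> comes from both actions and cancels, which
      leaves the commutator of \<open>b\<close> with \<open>x\<close>.\<close>
    moreover have "\<pi> (badd N (lact N z (j x)) (bscale N (-1) (ract N (j x) z))) = badd M
        (badd M (badd M (lact M b x) (bscale M \<beta> x)) (bscale M 0 (\<iota> b)))
        (bscale M (-1) (badd M (badd M (ract M x b) (bscale M \<beta> x)) (bscale M 0 (\<iota> b))))"
      unfolding z by (simp only: \<pi>_linear \<pi>_lact \<pi>_ract cl \<pi>_j \<sigma>_j)
    ultimately show "\<pi> (D z) = \<pi> (badd N (lact N z (j x)) (bscale N (-1) (ract N (j x) z)))"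
      unfolding eq by simp
    have "\<sigma> (D z) = 0"
      unfolding Dz by (simp only: \<sigma>_linear cl derivation_identity s) simp
    moreover have "\<sigma> (badd N (lact N z (j x)) (bscale N (-1) (ract N (j x) z))) = 0"
      unfolding z by (simp only: \<sigma>_linear \<sigma>_lact \<sigma>_ract cl \<sigma>_j \<epsilon>_eq_0) simp
    ultimately show "\<sigma> (D z) = \<sigma> (badd N (lact N z (j x)) (bscale N (-1) (ract N (j x) z)))"
      by simp
  qed (intro cl)+
  then show ?thesis unfolding inner_derivation_def using j_closed[OF x] by blast
qed

end

end

section \<open>Reduction to genuine strong duals and conclusion\<close>

text \<open>The strong dual lives on functions on \<open>'u\<close> and not on \<open>'u\<close>
  itself. This does no harm, since \<open>n_weakly_amenable_iff\<close> allows a realization on any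
  type.\<close>

lemma iterated_dual_as_strong_dual:
  fixes p :: "nat \<Rightarrow> 'b::complex_algebra \<Rightarrow> real"
  assumes "has_iterated_dual TYPE('u) (Suc n) p" and p: "\<And>l. submultiplicative_seminorm (p l)"
  obtains V :: "('b, 'u) bimodule" where "iterated_dual p (Suc n) (strong_dual V)"
proof -
  obtain X :: "('b, 'u) bimodule" where "iterated_dual p (Suc n) X"
    using assms(1) by (auto simp: has_iterated_dual_def)
  then obtain V :: "('b, 'u) bimodule" where "iterated_dual p n V" by cases
  then have "iterated_dual p (Suc n) (strong_dual V)" by (rule iterated_dual_strong_dual[OF _ p])
  then show thesis by (rule that)
qed

theorem corollary3p18:
  fixes p :: "nat \<Rightarrow> 'a::complex_algebra \<Rightarrow> real" and n :: nat
  assumes "frechet_algebra p"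
    and "weakly_amenable p"
    and "n \<ge> 1"
    and "has_iterated_dual TYPE('u) (2 * n) p"
    and "has_iterated_dual TYPE('v) (2 * n) (unitization_seminorms p)"
  shows "n_weakly_amenable TYPE('v) (2 * n) (unitization_seminorms p) \<longleftrightarrow>
         n_weakly_amenable TYPE('u) (2 * n) p"
proof -
  have p: "submultiplicative_seminorm (p l)" for l
    using assms(1) by (simp add: frechet_algebra_def)
  have q: "submultiplicative_seminorm (unitization_seminorms p l)" for l
    by (intro submultiplicative_unitization_seminorms p)
  \<comment> \<open>A positive index is needed for the last dual to be the strong dual of a
    preceding one.\<close>
  obtain m where m: "2 * n = Suc m" using assms(3) by (cases "2 * n") auto
  obtain V :: "('a, 'u) bimodule" where V: "iterated_dual p (2 * n) (strong_dual V)"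
    using iterated_dual_as_strong_dual[OF assms(4)[unfolded m] p] m by metis
  obtain W :: "('a unitization, 'v) bimodule"
    where W: "iterated_dual (unitization_seminorms p) (2 * n) (strong_dual W)"
    using iterated_dual_as_strong_dual[OF assms(5)[unfolded m] q] m by metis
  \<comment> \<open>Evenness of \<open>2 * n\<close> selects the case in which
    \<open>\<epsilon>\<close> vanishes.\<close>
  obtain j \<pi> \<sigma> u \<iota> \<epsilon> where "unitization_bimodule (strong_dual V) (strong_dual W) j \<pi> \<sigma> u \<iota> \<epsilon>"
    "\<forall>b x. \<epsilon> b x = 0"
    using iterated_dual_unitization_bimodule[OF V W p] by auto
  then interpret even_unitization_bimodule V W j \<pi> \<sigma> u \<iota> \<epsilon> p
    by (intro even_unitization_bimodule.intro even_unitization_bimodule_axioms.intro p) auto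
  show ?thesis
    \<comment> \<open>Both amenability properties may be tested on the chosen realizations
      \<open>strong_dual V\<close> and \<open>strong_dual W\<close>.\<close>
    unfolding n_weakly_amenable_iff[OF V p assms(4)] n_weakly_amenable_iff[OF W q assms(5)]
    using inner_if_inner_unitization inner_unitization_if_inner[OF _ assms(2)] by blast
qed

end
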